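(* Let $X=[0,1]^2$ be equipped with the $\ell^\infty$ metric $d_\infty$. Then the poset $\mathbf{Sq}_\bot$ of closed formal balls over $X$ with a bottom element adjoined is an FS-domain but is not an RB-domain.
   Context: The metric is $d_\infty((x,y),(x',y'))=\max\{|x-x'|,|y-y'|\}$. The poset of closed formal balls over $[0,1]^2$ is $\mathbf{Sq}=[0,1]^2\times[0,\infty)$ ordered by $(\mathbf c,r)\sqsubseteq(\mathbf c',r')\iff d_\infty(\mathbf c,\mathbf c')\le r-r'$. $\mathbf{Sq}_\bot=\mathbf{Sq}\cup\{\bot\}$ where $\bot$ is a new least element. A subset $A$ of a poset is directed if every finite subset of $A$ (including the empty one) has an upper bound in $A$. A dcpo is a poset in which every directed subset has a supremum; it is pointed if it has a least element. In a dcpo $D$, $x\ll y$ means: whenever $A\subseteq D$ is directed and $y\le\sup A$, there is $a\in A$ with $x\le a$. A domain is a continuous dcpo, i.e. a dcpo in which, for every $y$, the set $\{x\mid x\ll y\}$ is directed with supremum $y$. A map between dcpos is Scott-continuous if it is monotone and preserves directed suprema; $[D\to E]$ is the set of Scott-continuous maps, ordered pointwise (directed suprema are computed pointwise). Let $D$ be a pointed dcpo. An approximate identity on $D$ is a directed family $\mathcal A\subseteq[D\to D]$ with $\sup\mathcal A=\mathrm{id}_D$. A Scott-continuous $f\colon D\to D$ is finitely separated from the identity if there is a finite $M\subseteq D$ such that for every $x\in D$ some $m\in M$ satisfies $f(x)\le m\le x$. An FS-domain is a pointed dcpo carrying an approximate identity consisting of maps finitely separated from the identity. An element $k$ of a domain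 is compact if $k\ll k$; a domain is algebraic if every element is the directed supremum of the compact elements below it. A bifinite domain is an algebraic FS-domain. An RB-domain is a dcpo isomorphic to a Scott-continuous retract of a bifinite domain (i.e. a dcpo $D$ for which there are a bifinite domain $B$ and Scott-continuous maps $s\colon D\to B$, $p\colon B\to D$ with $p\circ s=\mathrm{id}_D$). *)

theory Defs
  imports Complex_Main "HOL-Algebra.Order"
begin

text \<open>
  Posets are the carrier-based orders of \<^theory>\<open>HOL-Algebra.Order\<close>; suprema are expressed by
  \<^term>\<open>is_lub D s A\<close>.
\<close>

text \<open>The case \<open>F = {}\<close> makes directed sets nonempty.\<close>

definition directed :: "'a gorder \<Rightarrow> 'a set \<Rightarrow> bool" where
  "directed D A \<longleftrightarrow> A \<subseteq> carrier D \<and>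
     (\<forall>F. finite F \<and> F \<subseteq> A \<longrightarrow> (\<exists>a\<in>A. \<forall>x\<in>F. x \<sqsubseteq>\<^bsub>D\<^esub> a))"

definition dcpo :: "'a gorder \<Rightarrow> bool" where
  "dcpo D \<longleftrightarrow> partial_order D \<and> (\<forall>A. directed D A \<longrightarrow> (\<exists>s. is_lub D s A))"

definition pointed_dcpo :: "'a gorder \<Rightarrow> bool" where
  "pointed_dcpo D \<longleftrightarrow> dcpo D \<and> (\<exists>b. least D b (carrier D))"

definition way_below :: "'a gorder \<Rightarrow> 'a \<Rightarrow> 'a \<Rightarrow> bool" where
  "way_below D x y \<longleftrightarrow> x \<in> carrier D \<and> y \<in> carrier D \<and>
     (\<forall>A s. directed D A \<and> is_lub D s A \<and> y \<sqsubseteq>\<^bsub>D\<^esub> s \<longrightarrow> (\<exists>a\<in>A. x \<sqsubseteq>\<^bsub>D\<^esub> a))"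

definition continuous_dcpo :: "'a gorder \<Rightarrow> bool" where
  "continuous_dcpo D \<longleftrightarrow> dcpo D \<and>
     (\<forall>y\<in>carrier D. directed D {x. way_below D x y} \<and> is_lub D y {x. way_below D x y})"

definition compact_element :: "'a gorder \<Rightarrow> 'a \<Rightarrow> bool" where
  "compact_element D k \<longleftrightarrow> way_below D k k"

definition algebraic_domain :: "'a gorder \<Rightarrow> bool" where
  "algebraic_domain D \<longleftrightarrow> continuous_dcpo D \<and>
     (\<forall>x\<in>carrier D. directed D {k. compact_element D k \<and> k \<sqsubseteq>\<^bsub>D\<^esub> x} \<and>
        is_lub D x {k. compact_element D k \<and> k \<sqsubseteq>\<^bsub>D\<^esub> x})"

definition scott_continuous :: "'a gorder \<Rightarrow> 'b gorder \<Rightarrow> ('a \<Rightarrow> 'b) \<Rightarrow> bool" where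
  "scott_continuous D E f \<longleftrightarrow> f \<in> carrier D \<rightarrow> carrier E \<and> isotone D E f \<and>
     (\<forall>A s. directed D A \<and> is_lub D s A \<longrightarrow> is_lub E (f s) (f ` A))"

text \<open>
  The carrier consists of extensional functions, so that maps which agree on \<^term>\<open>carrier D\<close>
  are equal and the pointwise order is antisymmetric.
\<close>

definition scott_maps :: "'a gorder \<Rightarrow> 'b gorder \<Rightarrow> ('a \<Rightarrow> 'b) gorder" where
  "scott_maps D E =
     \<lparr> carrier = {f \<in> carrier D \<rightarrow>\<^sub>E carrier E. scott_continuous D E f},
       eq = (=),
       le = (\<lambda>f g. \<forall>x\<in>carrier D. f x \<sqsubseteq>\<^bsub>E\<^esub> g x) \<rparr>"

definition approximate_identity :: "'a gorder \<Rightarrow> ('a \<Rightarrow> 'a) set \<Rightarrow> bool" where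
  "approximate_identity D \<A> \<longleftrightarrow>
     directed (scott_maps D D) \<A> \<and> is_lub (scott_maps D D) (\<lambda>x\<in>carrier D. x) \<A>"

definition finitely_separated :: "'a gorder \<Rightarrow> ('a \<Rightarrow> 'a) \<Rightarrow> bool" where
  "finitely_separated D f \<longleftrightarrow> scott_continuous D D f \<and>
     (\<exists>M. finite M \<and> M \<subseteq> carrier D \<and>
        (\<forall>x\<in>carrier D. \<exists>m\<in>M. f x \<sqsubseteq>\<^bsub>D\<^esub> m \<and> m \<sqsubseteq>\<^bsub>D\<^esub> x))"

definition FS_domain :: "'a gorder \<Rightarrow> bool" where
  "FS_domain D \<longleftrightarrow> pointed_dcpo D \<and>
     (\<exists>\<A>. approximate_identity D \<A> \<and> (\<forall>f\<in>\<A>. finitely_separated D f))"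

definition bifinite_domain :: "'a gorder \<Rightarrow> bool" where
  "bifinite_domain D \<longleftrightarrow> algebraic_domain D \<and> FS_domain D"

text \<open>
  HOL cannot quantify over types inside a formula, so the type \<^typ>\<open>'b\<close> of the elements of the
  bifinite domain is a parameter.  Being an RB-domain means that \<open>RB_domain TYPE('b) D\<close> holds for
  some type; a theorem \<open>\<not> RB_domain TYPE('b) D\<close> with \<^typ>\<open>'b\<close> schematic denies it for all types.
\<close>

definition RB_domain :: "'b itself \<Rightarrow> 'a gorder \<Rightarrow> bool" where
  "RB_domain _ D \<longleftrightarrow> dcpo D \<and>
     (\<exists>(B :: 'b gorder) s p. bifinite_domain B \<and> scott_continuous D B s \<and> scott_continuous B D p \<and>
        (\<forall>x\<in>carrier D. p (s x) = x))"

definition formal_balls :: "'a set \<Rightarrow> ('a \<Rightarrow> 'a \<Rightarrow> real) \<Rightarrow> ('a \<times> real) gorder" where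
  "formal_balls X d =
     \<lparr> carrier = X \<times> {0..},
       eq = (=),
       le = (\<lambda>(c, r) (c', r'). d c c' \<le> r - r') \<rparr>"

text \<open>\<^const>\<open>None\<close> is the new least element.\<close>

definition adjoin_bottom :: "'a gorder \<Rightarrow> 'a option gorder" where
  "adjoin_bottom D =
     \<lparr> carrier = insert None (Some ` carrier D),
       eq = (=),
       le = (\<lambda>x y. case x of None \<Rightarrow> True
                   | Some a \<Rightarrow> (case y of None \<Rightarrow> False | Some b \<Rightarrow> a \<sqsubseteq>\<^bsub>D\<^esub> b)) \<rparr>"

definition d_inf :: "real \<times> real \<Rightarrow> real \<times> real \<Rightarrow> real" where
  "d_inf = (\<lambda>(x, y) (x', y'). max \<bar>x - x'\<bar> \<bar>y - y'\<bar>)"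

definition Sq :: "((real \<times> real) \<times> real) gorder" where
  "Sq = formal_balls ({0..1} \<times> {0..1}) d_inf"

definition Sq_bot :: "((real \<times> real) \<times> real) option gorder" where
  "Sq_bot = adjoin_bottom Sq"

end

theory Submission
  imports Defs
begin

text \<open>
  A formal ball over the unit square is read as an axis-parallel square with centre in
  \<open>[0,1]\<^sup>2\<close>, and going up in the order means shrinking.  Each of the four sides then moves inwards,
  so with signs chosen appropriately the order is the coordinatewise order of four real numbers
  \<open>west\<close>, \<open>east\<close>, \<open>south\<close>, \<open>north\<close>; these satisfy the single linear relation
  \<open>west + east = south + north\<close>, since both sums are \<open>- 2 r\<close>.

  The FS part rests on compactness of the unit square: adding \<open>1/n\<close> to the radius (and sending
  radii \<open>\<ge> n\<close> to \<open>\<bottom>\<close>) is Scott-continuous, a grid of mesh \<open>1/(4n)\<close> separates this map from the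
  identity, and the maps increase to the identity (\<open>FS_domain_Sq_bot\<close>).

  The negative part has an order-theoretic and a combinatorial half.  In an algebraic FS-domain
  finitely many compact elements are fixed by one map \<open>f\<close> of the approximate identity, and a
  fixed power of \<open>f\<close> has finite range, because every decreasing orbit becomes stationary at an element of
  the separating set.  Transporting such powers along a retraction shows that on an RB-domain the
  second iterate of any finitely separated map lies below a monotone map of finite range which itself lies
  below the identity (\<open>RB_domain_finite_range_approximation\<close>).  For squares this would
  yield a monotone rounding \<open>g\<close> of finite range with \<open>(c, r + 1/64) \<sqsubseteq> g (c, r) \<sqsubseteq> (c, r)\<close>, and
  this is impossible (\<open>finite_rounding_impossible\<close>).

  Heuristically, a finite-range \<open>g\<close> is a step function, and across a generic point of a jump surface
  only two values of \<open>g\<close> occur, so all four side functions of \<open>g\<close> jump together there, across a surface with one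
  normal \<open>\<nu>\<close>.  As \<open>g\<close> is close to the identity, the function \<open>west \<circ> g\<close> must jump almost
  exclusively across surfaces whose normal is the gradient of \<open>west\<close>, and similarly for the other
  three sides.  But \<open>west + east = south + north\<close> also holds for the jumps, so a jump of
  \<open>west\<close> forces one of \<open>south\<close> or \<open>north\<close> on the same surface, where almost no jumps of these
  functions are available.

  The proof makes this discrete.  On a lattice of \<open>N\<^sup>3\<close> squares and for a step \<open>s\<close> of the lattice,
  the increments of the sides telescope, so their averages are known.  At a place where \<open>g\<close> takes at
  most two values on a point and two of its neighbours, the increment of \<open>west\<close> is bounded by three
  increments of small average (\<open>west_increment_le\<close>).  Hence at least \<open>N\<^sup>2 s / 16\<close> places are
  branching, with three distinct values (\<open>card_branching_ge\<close>).  A branching place lies near two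
  distinct but close boundaries of upper sets \<open>{z. v \<sqsubseteq> g z}\<close>, and along a line two boundaries at a
  given distance \<open>d\<close> are noticed at few scales: \<open>s\<close> has to exceed \<open>d/2\<close>, and then only \<open>d\<close> points
  count.  Therefore the number of branching places divided by \<open>N\<^sup>2 s\<close>, summed over all scales
  \<open>s = 2\<^sup>l\<close>, is bounded by a multiple of the squared size of the range of \<open>g\<close>
  (\<open>sum_card_crossings_le\<close>), whereas the lower bound makes it grow linearly with the number of
  scales.
\<close>

section \<open>Least upper bounds and Scott-continuous maps\<close>

lemma is_lub_iff:
  assumes "A \<subseteq> carrier D"
  shows "is_lub D s A \<longleftrightarrow> s \<in> carrier D \<and> (\<forall>a\<in>A. a \<sqsubseteq>\<^bsub>D\<^esub> s) \<and>
    (\<forall>t\<in>carrier D. (\<forall>a\<in>A. a \<sqsubseteq>\<^bsub>D\<^esub> t) \<longrightarrow> s \<sqsubseteq>\<^bsub>D\<^esub> t)"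
proof -
  have "A \<inter> carrier D = A" using assms by blast
  then show ?thesis unfolding least_def Upper_def by auto
qed

lemma is_lubD:
  assumes "A \<subseteq> carrier D" "is_lub D s A"
  shows "s \<in> carrier D" and "a \<in> A \<Longrightarrow> a \<sqsubseteq>\<^bsub>D\<^esub> s"
    and "t \<in> carrier D \<Longrightarrow> (\<And>a. a \<in> A \<Longrightarrow> a \<sqsubseteq>\<^bsub>D\<^esub> t) \<Longrightarrow> s \<sqsubseteq>\<^bsub>D\<^esub> t"
  using assms(2) unfolding is_lub_iff[OF assms(1)] by blast+

lemma is_lubI:
  assumes "A \<subseteq> carrier D" "s \<in> carrier D" "\<And>a. a \<in> A \<Longrightarrow> a \<sqsubseteq>\<^bsub>D\<^esub> s"
    and "\<And>t. t \<in> carrier D \<Longrightarrow> (\<And>a. a \<in> A \<Longrightarrow> a \<sqsubseteq>\<^bsub>D\<^esub> t) \<Longrightarrow> s \<sqsubseteq>\<^bsub>D\<^esub> t"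
  shows "is_lub D s A"
  unfolding is_lub_iff[OF assms(1)] using assms(2-) by blast

lemma partial_order_facts:
  assumes "partial_order D"
  shows "x \<in> carrier D \<Longrightarrow> x \<sqsubseteq>\<^bsub>D\<^esub> x"
    and "\<lbrakk>x \<sqsubseteq>\<^bsub>D\<^esub> y; y \<sqsubseteq>\<^bsub>D\<^esub> z; x \<in> carrier D; y \<in> carrier D; z \<in> carrier D\<rbrakk> \<Longrightarrow> x \<sqsubseteq>\<^bsub>D\<^esub> z"
    and "\<lbrakk>x \<sqsubseteq>\<^bsub>D\<^esub> y; y \<sqsubseteq>\<^bsub>D\<^esub> x; x \<in> carrier D; y \<in> carrier D\<rbrakk> \<Longrightarrow> x = y"
proof -
  interpret partial_order D by (rule assms)
  show "x \<in> carrier D \<Longrightarrow> x \<sqsubseteq>\<^bsub>D\<^esub> x" by simp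
  show "\<lbrakk>x \<sqsubseteq>\<^bsub>D\<^esub> y; y \<sqsubseteq>\<^bsub>D\<^esub> z; x \<in> carrier D; y \<in> carrier D; z \<in> carrier D\<rbrakk> \<Longrightarrow> x \<sqsubseteq>\<^bsub>D\<^esub> z"
    by (rule le_trans)
  show "\<lbrakk>x \<sqsubseteq>\<^bsub>D\<^esub> y; y \<sqsubseteq>\<^bsub>D\<^esub> x; x \<in> carrier D; y \<in> carrier D\<rbrakk> \<Longrightarrow> x = y"
    by (rule le_antisym)
qed

lemmas po_refl = partial_order_facts(1)
lemmas po_trans = partial_order_facts(2)
lemmas po_antisym = partial_order_facts(3)

lemma dcpo_partial_order: "dcpo D \<Longrightarrow> partial_order D"
  by (simp add: dcpo_def)

lemma partial_order_weak: "partial_order D \<Longrightarrow> weak_partial_order D"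
  by (simp add: partial_order_def)

lemma directedD:
  assumes "directed D A"
  shows "A \<subseteq> carrier D" and "finite F \<Longrightarrow> F \<subseteq> A \<Longrightarrow> \<exists>a\<in>A. \<forall>x\<in>F. x \<sqsubseteq>\<^bsub>D\<^esub> a"
  using assms by (auto simp: directed_def)

lemma directed_nonempty: "directed D A \<Longrightarrow> A \<noteq> {}"
  using directedD(2)[of D A "{}"] by auto

lemma directed_image:
  assumes "directed D A" and "f ` A \<subseteq> carrier E"
    and "\<And>x y. \<lbrakk>x \<in> A; y \<in> A; x \<sqsubseteq>\<^bsub>D\<^esub> y\<rbrakk> \<Longrightarrow> f x \<sqsubseteq>\<^bsub>E\<^esub> f y"
  shows "directed E (f ` A)"
  unfolding directed_def
proof (intro conjI allI impI)
  fix F assume "finite F \<and> F \<subseteq> f ` A"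
  then obtain F' where F': "F' \<subseteq> A" "finite F'" "F = f ` F'" by (meson finite_subset_image)
  from directedD(2)[OF assms(1) F'(2,1)] obtain a where "a \<in> A" "\<forall>x\<in>F'. x \<sqsubseteq>\<^bsub>D\<^esub> a" by blast
  then show "\<exists>a\<in>f ` A. \<forall>x\<in>F. x \<sqsubseteq>\<^bsub>E\<^esub> a" using F' assms(3) by blast
qed (rule assms(2))

lemma scott_continuousD:
  assumes "scott_continuous D E f"
  shows "x \<in> carrier D \<Longrightarrow> f x \<in> carrier E"
    and "\<lbrakk>x \<sqsubseteq>\<^bsub>D\<^esub> y; x \<in> carrier D; y \<in> carrier D\<rbrakk> \<Longrightarrow> f x \<sqsubseteq>\<^bsub>E\<^esub> f y"
    and "directed D A \<Longrightarrow> is_lub D s A \<Longrightarrow> is_lub E (f s) (f ` A)"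
  using assms by (auto simp: scott_continuous_def isotone_def)

lemma directed_scott_image:
  assumes "scott_continuous D E f" "directed D A"
  shows "directed E (f ` A)"
  using directedD(1)[OF assms(2)]
  by (intro directed_image[OF assms(2)]) (blast intro: scott_continuousD(1,2)[OF assms(1)])+

lemma scott_maps_carrier_iff:
  "f \<in> carrier (scott_maps D E) \<longleftrightarrow> f \<in> extensional (carrier D) \<and> scott_continuous D E f"
  by (auto simp: scott_maps_def scott_continuous_def PiE_def)

lemma scott_maps_le_iff:
  "f \<sqsubseteq>\<^bsub>scott_maps D E\<^esub> g \<longleftrightarrow> (\<forall>x\<in>carrier D. f x \<sqsubseteq>\<^bsub>E\<^esub> g x)"
  by (simp add: scott_maps_def)

lemma directed_scott_maps_eval:
  assumes "directed (scott_maps D E) \<A>" "x \<in> carrier D"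
  shows "directed E ((\<lambda>f. f x) ` \<A>)"
proof (rule directed_image[OF assms(1)])
  show "(\<lambda>f. f x) ` \<A> \<subseteq> carrier E"
    using directedD(1)[OF assms(1)] assms(2)
    by (fastforce simp: scott_maps_carrier_iff subset_iff dest: scott_continuousD(1))
qed (use assms(2) in \<open>auto simp: scott_maps_le_iff\<close>)

text \<open>
  Suprema commute with suprema: if \<open>t\<close> bounds \<open>F a\<close> for all \<open>a
  \<in> X\<close>, it bounds every \<open>f a\<close>, hence \<open>f (sup X)\<close> for every
  \<open>f \<in> \<A>\<close>, hence \<open>F (sup X)\<close>.
\<close>

lemma scott_continuous_pointwise_lub:
  assumes po: "partial_order D" "partial_order E"
    and \<A>: "\<And>f. f \<in> \<A> \<Longrightarrow> scott_continuous D E f"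
    and F: "\<And>x. x \<in> carrier D \<Longrightarrow> is_lub E (F x) ((\<lambda>f. f x) ` \<A>)"
  shows "scott_continuous D E F"
proof -
  have sub: "(\<lambda>f. f x) ` \<A> \<subseteq> carrier E" if "x \<in> carrier D" for x
    using scott_continuousD(1)[OF \<A> that] by blast
  have FE: "F x \<in> carrier E" if "x \<in> carrier D" for x
    by (rule is_lubD(1)[OF sub F]) (use that in auto)
  have ub: "f x \<sqsubseteq>\<^bsub>E\<^esub> F x" if "f \<in> \<A>" "x \<in> carrier D" for f x
    by (rule is_lubD(2)[OF sub F]) (use that in auto)
  have least: "F x \<sqsubseteq>\<^bsub>E\<^esub> t" if "x \<in> carrier D" "t \<in> carrier E" "\<And>f. f \<in> \<A> \<Longrightarrow> f x \<sqsubseteq>\<^bsub>E\<^esub> t" for x t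
    by (rule is_lubD(3)[OF sub F]) (use that in auto)
  have mono: "F x \<sqsubseteq>\<^bsub>E\<^esub> F y" if "x \<sqsubseteq>\<^bsub>D\<^esub> y" "x \<in> carrier D" "y \<in> carrier D" for x y
  proof (rule least[OF that(2) FE[OF that(3)]])
    fix f assume f: "f \<in> \<A>"
    note sc = \<A>[OF f]
    show "f x \<sqsubseteq>\<^bsub>E\<^esub> F y"
      by (rule po_trans[OF po(2) scott_continuousD(2)[OF sc that] ub[OF f that(3)]])
        (use that FE scott_continuousD(1)[OF sc] in auto)
  qed
  show ?thesis unfolding scott_continuous_def isotone_def
  proof (intro conjI allI impI)
    fix X s assume "directed D X \<and> is_lub D s X"
    then have X: "directed D X" "is_lub D s X" by auto
    have XD: "X \<subseteq> carrier D" by (rule directedD(1)[OF X(1)])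
    have s: "s \<in> carrier D" by (rule is_lubD(1)[OF XD X(2)])
    show "is_lub E (F s) (F ` X)"
    proof (rule is_lubI)
      show "F ` X \<subseteq> carrier E" using XD FE by auto
      show "F s \<in> carrier E" by (rule FE[OF s])
      show "a \<sqsubseteq>\<^bsub>E\<^esub> F s" if "a \<in> F ` X" for a
        using that mono is_lubD(2)[OF XD X(2)] s XD by auto
    next
      fix t assume t: "t \<in> carrier E" "\<And>a. a \<in> F ` X \<Longrightarrow> a \<sqsubseteq>\<^bsub>E\<^esub> t"
      show "F s \<sqsubseteq>\<^bsub>E\<^esub> t"
      proof (rule least[OF s t(1)])
        fix f assume f: "f \<in> \<A>"
        note sc = \<A>[OF f]
        have fX: "f ` X \<subseteq> carrier E" using scott_continuousD(1)[OF sc] XD by auto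
        show "f s \<sqsubseteq>\<^bsub>E\<^esub> t"
        proof (rule is_lubD(3)[OF fX scott_continuousD(3)[OF sc X] t(1)])
          fix a assume "a \<in> f ` X"
          then obtain x where x: "x \<in> X" "a = f x" by blast
          have "f x \<sqsubseteq>\<^bsub>E\<^esub> t"
            by (rule po_trans[OF po(2) ub[OF f] t(2)]) (use x XD FE scott_continuousD(1)[OF sc] t(1) in auto)
          then show "a \<sqsubseteq>\<^bsub>E\<^esub> t" by (simp add: x)
        qed
      qed
    qed
  qed (use po partial_order_weak FE mono in auto)
qed

text \<open>
  The supremum in the definition of an approximate identity is taken in the poset of
  Scott-continuous maps.  Pointwise suprema exist in a dcpo and form a Scott-continuous map, which
  is above the identity by leastness and below it because every member of \<open>\<A>\<close> is.
\<close>

lemma approximate_identity_pointwise: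
  assumes D: "dcpo D" and \<A>: "approximate_identity D \<A>" and x: "x \<in> carrier D"
  shows "is_lub D x ((\<lambda>f. f x) ` \<A>)"
proof -
  note po = dcpo_partial_order[OF D]
  have dir: "directed (scott_maps D D) \<A>"
    and lub: "is_lub (scott_maps D D) (\<lambda>x\<in>carrier D. x) \<A>"
    using \<A> by (auto simp: approximate_identity_def)
  note sub = directedD(1)[OF dir]
  have sc: "scott_continuous D D f" if "f \<in> \<A>" for f
    using sub that by (auto simp: scott_maps_carrier_iff)
  have "\<exists>y. is_lub D y ((\<lambda>f. f x) ` \<A>)" if "x \<in> carrier D" for x
    using D directed_scott_maps_eval[OF dir that] unfolding dcpo_def by blast
  then obtain F where F: "\<And>x. x \<in> carrier D \<Longrightarrow> is_lub D (F x) ((\<lambda>f. f x) ` \<A>)" by metis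
  define F' where "F' = restrict F (carrier D)"
  have F': "is_lub D (F' x) ((\<lambda>f. f x) ` \<A>)" if "x \<in> carrier D" for x
    using F that by (simp add: F'_def)
  have im: "(\<lambda>f. f x) ` \<A> \<subseteq> carrier D" if "x \<in> carrier D" for x
    using scott_continuousD(1)[OF sc that] by blast
  have "F' \<in> extensional (carrier D)" by (simp add: F'_def)
  then have "F' \<in> carrier (scott_maps D D)"
    using scott_continuous_pointwise_lub[OF po po sc F'] by (simp add: scott_maps_carrier_iff)
  then have "(\<lambda>x\<in>carrier D. x) \<sqsubseteq>\<^bsub>scott_maps D D\<^esub> F'"
    by (rule is_lubD(3)[OF sub lub]) (use is_lubD(2)[OF im F'] in \<open>auto simp: scott_maps_le_iff\<close>)
  then have "x \<sqsubseteq>\<^bsub>D\<^esub> F' x" using x by (auto simp: scott_maps_le_iff)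
  moreover have "F' x \<sqsubseteq>\<^bsub>D\<^esub> x"
    by (rule is_lubD(3)[OF im[OF x] F'[OF x] x])
      (use is_lubD(2)[OF sub lub] x in \<open>auto simp: scott_maps_le_iff\<close>)
  ultimately have "F' x = x"
    using po_antisym[OF po] x is_lubD(1)[OF im[OF x] F'[OF x]] by blast
  then show ?thesis using F'[OF x] by simp
qed

section \<open>Finite-range approximations of RB-domains\<close>

text \<open>
  For a directed set \<open>A\<close> the finitely many separating elements cannot all fail
  eventually, so one of them, \<open>m\<close>, separates \<open>f a\<close> from \<open>a\<close>
  for cofinally many \<open>a \<in> A\<close>.  Then \<open>f (sup A) \<sqsubseteq> m\<close> by
  continuity, and \<open>m\<close> is below a member of \<open>A\<close>.
\<close>

lemma finitely_separated_way_below: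
  assumes D: "dcpo D" and f: "finitely_separated D f" and x: "x \<in> carrier D"
  shows "way_below D (f x) x"
proof -
  note po = dcpo_partial_order[OF D]
  obtain M where M: "finite M" "M \<subseteq> carrier D"
    and sep: "\<And>x. x \<in> carrier D \<Longrightarrow> \<exists>m\<in>M. f x \<sqsubseteq>\<^bsub>D\<^esub> m \<and> m \<sqsubseteq>\<^bsub>D\<^esub> x"
    and sc: "scott_continuous D D f"
    using f by (auto simp: finitely_separated_def)
  have fD: "f y \<in> carrier D" if "y \<in> carrier D" for y by (rule scott_continuousD(1)[OF sc that])
  have "\<exists>a\<in>A. f x \<sqsubseteq>\<^bsub>D\<^esub> a" if A: "directed D A" and s: "is_lub D s A" and xs: "x \<sqsubseteq>\<^bsub>D\<^esub> s" for A s
  proof -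
    note AD = directedD(1)[OF A]
    note sD = is_lubD(1)[OF AD s]
    obtain m where m: "m \<in> M" and cofinal: "\<And>a. a \<in> A \<Longrightarrow> \<exists>b\<in>A. a \<sqsubseteq>\<^bsub>D\<^esub> b \<and> f b \<sqsubseteq>\<^bsub>D\<^esub> m \<and> m \<sqsubseteq>\<^bsub>D\<^esub> b"
    proof (rule ccontr)
      assume "\<not> thesis"
      then have "\<forall>m\<in>M. \<exists>a. a \<in> A \<and> (\<forall>b\<in>A. a \<sqsubseteq>\<^bsub>D\<^esub> b \<longrightarrow> f b \<sqsubseteq>\<^bsub>D\<^esub> m \<longrightarrow> \<not> m \<sqsubseteq>\<^bsub>D\<^esub> b)" using that by blast
      from bchoice[OF this] obtain w where w: "\<And>m. m \<in> M \<Longrightarrow> w m \<in> A"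
        and no: "\<And>m b. m \<in> M \<Longrightarrow> b \<in> A \<Longrightarrow> w m \<sqsubseteq>\<^bsub>D\<^esub> b \<Longrightarrow> f b \<sqsubseteq>\<^bsub>D\<^esub> m \<Longrightarrow> m \<sqsubseteq>\<^bsub>D\<^esub> b \<Longrightarrow> False"
        by blast
      have "finite (w ` M)" "w ` M \<subseteq> A" using M w by auto
      from directedD(2)[OF A this] obtain b where b: "b \<in> A" "\<And>m. m \<in> M \<Longrightarrow> w m \<sqsubseteq>\<^bsub>D\<^esub> b" by blast
      then show False using sep[of b] no AD by blast
    qed
    have "f s \<sqsubseteq>\<^bsub>D\<^esub> m"
    proof (rule is_lubD(3)[OF _ scott_continuousD(3)[OF sc A s]])
      show "f ` A \<subseteq> carrier D" using AD fD by auto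
      show "m \<in> carrier D" using m M by auto
    next
      fix c assume "c \<in> f ` A"
      then obtain a where a: "a \<in> A" "c = f a" by blast
      obtain b where b: "b \<in> A" "a \<sqsubseteq>\<^bsub>D\<^esub> b" "f b \<sqsubseteq>\<^bsub>D\<^esub> m" using cofinal[OF a(1)] by blast
      have "f a \<sqsubseteq>\<^bsub>D\<^esub> f b" using scott_continuousD(2)[OF sc b(2)] a b AD by auto
      moreover have "f a \<in> carrier D" "f b \<in> carrier D" "m \<in> carrier D" using a b AD fD m M by auto
      ultimately show "c \<sqsubseteq>\<^bsub>D\<^esub> m" unfolding a(2) by (intro po_trans[OF po _ b(3)])
    qed
    moreover obtain b where b: "b \<in> A" "m \<sqsubseteq>\<^bsub>D\<^esub> b"
      using cofinal directed_nonempty[OF A] by blast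
    moreover have "f x \<sqsubseteq>\<^bsub>D\<^esub> f s" by (rule scott_continuousD(2)[OF sc xs x sD])
    moreover have "m \<in> carrier D" "b \<in> carrier D" using m M b AD by auto
    ultimately have "f x \<sqsubseteq>\<^bsub>D\<^esub> m" "m \<sqsubseteq>\<^bsub>D\<^esub> b" "m \<in> carrier D" "b \<in> carrier D"
      using po_trans[OF po _ _ fD[OF x] fD[OF sD]] by blast+
    then have "f x \<sqsubseteq>\<^bsub>D\<^esub> b" by (rule po_trans[OF po _ _ fD[OF x]])
    then show ?thesis using b by blast
  qed
  then show ?thesis unfolding way_below_def using x fD by blast
qed

text \<open>
  Along the decreasing orbit of \<open>x\<close>, each step passes through an element of
  \<open>M\<close>.  By the pigeonhole principle some element occurs twice, and the orbit is
  constant in between and from then on.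
\<close>

lemma finitely_separated_iterate_in:
  assumes po: "partial_order D" and mem: "\<And>x. x \<in> carrier D \<Longrightarrow> f x \<in> carrier D"
    and M: "finite M" "M \<subseteq> carrier D"
    and sep: "\<And>x. x \<in> carrier D \<Longrightarrow> \<exists>m\<in>M. f x \<sqsubseteq>\<^bsub>D\<^esub> m \<and> m \<sqsubseteq>\<^bsub>D\<^esub> x"
    and x: "x \<in> carrier D"
  shows "(f ^^ (2 * card M + 1)) x \<in> M"
proof -
  define y where "y i = (f ^^ i) x" for i
  have yD: "y i \<in> carrier D" for i by (induction i) (auto simp: y_def x mem)
  have yS: "y (Suc i) = f (y i)" for i by (simp add: y_def)
  obtain m where m: "\<And>i. m i \<in> M" "\<And>i. y (Suc i) \<sqsubseteq>\<^bsub>D\<^esub> m i" "\<And>i. m i \<sqsubseteq>\<^bsub>D\<^esub> y i"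
    using sep[OF yD] unfolding yS by metis
  have mD: "m i \<in> carrier D" for i using m(1) M(2) by auto
  have dec: "y j \<sqsubseteq>\<^bsub>D\<^esub> y i" if "i \<le> j" for i j
    using that
  proof (induction rule: dec_induct)
    case base show ?case by (rule po_refl[OF po yD])
  next
    case (step n)
    have "y (Suc n) \<sqsubseteq>\<^bsub>D\<^esub> y n" by (rule po_trans[OF po m(2) m(3)]) (auto simp: yD mD)
    then show ?case by (rule po_trans[OF po _ step.IH]) (rule yD)+
  qed
  \<comment> \<open>Only even indices are compared: the two occurrences must be at least two steps apart, so
      that a full step of the orbit lies between them.\<close>
  have "\<not> inj_on (\<lambda>a. m (2 * a)) {..card M}"
  proof
    assume "inj_on (\<lambda>a. m (2 * a)) {..card M}"
    then have "card {..card M} \<le> card M" by (rule card_inj_on_le) (use m M in auto)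
    then show False by simp
  qed
  then obtain a b where ab: "a \<le> card M" "b \<le> card M" "a \<noteq> b" "m (2 * a) = m (2 * b)"
    by (auto simp: inj_on_def)
  define i j where "i = 2 * min a b" and "j = 2 * max a b"
  have ij: "i + 2 \<le> j" "j \<le> 2 * card M" "m i = m j"
    using ab by (auto simp: i_def j_def min_def max_def)
  have low: "m i \<sqsubseteq>\<^bsub>D\<^esub> y (Suc (Suc i))"
    using po_trans[OF po m(3)[of j] dec[OF ij(1)] mD yD yD] ij(3) by simp
  have step: "y (Suc (Suc i)) \<sqsubseteq>\<^bsub>D\<^esub> y (Suc i)" by (rule dec) simp
  have "m i \<sqsubseteq>\<^bsub>D\<^esub> y (Suc i)" by (rule po_trans[OF po low step mD yD yD])
  then have eq: "y (Suc i) = m i" by (rule po_antisym[OF po m(2) _ yD mD])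
  have "y (Suc (Suc i)) = y (Suc i)"
    by (rule po_antisym[OF po step _ yD yD]) (use low eq in simp)
  then have fixed: "f (y (Suc i)) = y (Suc i)" by (simp only: yS)
  have "y (Suc i + n) = m i" for n
    by (induction n) (use eq fixed in \<open>simp_all add: yS del: funpow.simps\<close>)
  from this[of "2 * card M - i"] show ?thesis using ij m(1) by (simp add: y_def)
qed

lemma iterate_mono:
  assumes "scott_continuous D D f" "x \<in> carrier D" "y \<in> carrier D" "x \<sqsubseteq>\<^bsub>D\<^esub> y"
  shows "(f ^^ n) x \<in> carrier D \<and> (f ^^ n) x \<sqsubseteq>\<^bsub>D\<^esub> (f ^^ n) y"
proof -
  have "(f ^^ n) x \<in> carrier D \<and> (f ^^ n) y \<in> carrier D \<and> (f ^^ n) x \<sqsubseteq>\<^bsub>D\<^esub> (f ^^ n) y"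
    by (induction n) (use assms in \<open>auto intro: scott_continuousD\<close>)
  then show ?thesis by blast
qed

lemma iterate_deflationary:
  assumes "partial_order D" "scott_continuous D D f" "\<And>x. x \<in> carrier D \<Longrightarrow> f x \<sqsubseteq>\<^bsub>D\<^esub> x" "x \<in> carrier D"
  shows "(f ^^ n) x \<sqsubseteq>\<^bsub>D\<^esub> x"
proof -
  have "(f ^^ n) x \<in> carrier D \<and> (f ^^ n) x \<sqsubseteq>\<^bsub>D\<^esub> x"
  proof (induction n)
    case (Suc n)
    then have n: "(f ^^ n) x \<in> carrier D" "(f ^^ n) x \<sqsubseteq>\<^bsub>D\<^esub> x" by auto
    have "f ((f ^^ n) x) \<sqsubseteq>\<^bsub>D\<^esub> x"
      by (rule po_trans[OF assms(1) assms(3)[OF n(1)] n(2)]) (use n assms scott_continuousD(1)[OF assms(2)] in auto)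
    then show ?case using scott_continuousD(1)[OF assms(2) n(1)] by simp
  qed (use assms po_refl in auto)
  then show ?thesis by blast
qed

text \<open>
  A compact \<open>k\<close> satisfies \<open>k \<sqsubseteq> f k\<close> for some
  \<open>f\<close> in the approximate identity, as it is the directed supremum of the values
  \<open>f k\<close>.  One \<open>f\<close> serves for all of \<open>K\<close>, fixes
  \<open>K\<close> pointwise, and so does the power of \<open>f\<close> whose range lies in the
  finite separating set.
\<close>

lemma bifinite_domain_deflation:
  assumes B: "bifinite_domain B" and K: "finite K" "\<And>k. k \<in> K \<Longrightarrow> compact_element B k"
  obtains h where "finite (h ` carrier B)" "\<And>x. x \<in> carrier B \<Longrightarrow> h x \<in> carrier B \<and> h x \<sqsubseteq>\<^bsub>B\<^esub> x"
    and "\<And>x y. \<lbrakk>x \<in> carrier B; y \<in> carrier B; x \<sqsubseteq>\<^bsub>B\<^esub> y\<rbrakk> \<Longrightarrow> h x \<sqsubseteq>\<^bsub>B\<^esub> h y"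
    and "\<And>k. k \<in> K \<Longrightarrow> h k = k"
proof -
  obtain \<A> where dcpo: "dcpo B" and \<A>: "approximate_identity B \<A>" and fs: "\<And>f. f \<in> \<A> \<Longrightarrow> finitely_separated B f"
    using B by (auto simp: bifinite_domain_def FS_domain_def pointed_dcpo_def)
  note po = dcpo_partial_order[OF dcpo]
  have dir: "directed (scott_maps B B) \<A>" using \<A> by (simp add: approximate_identity_def)
  have kB: "k \<in> carrier B" if "k \<in> K" for k using K(2)[OF that] by (simp add: compact_element_def way_below_def)
  have sc: "scott_continuous B B f" if "f \<in> \<A>" for f using fs[OF that] by (simp add: finitely_separated_def)
  have "\<exists>f\<in>\<A>. k \<sqsubseteq>\<^bsub>B\<^esub> f k" if k: "k \<in> K" for k
    using K(2)[OF k] approximate_identity_pointwise[OF dcpo \<A> kB[OF k]] directed_scott_maps_eval[OF dir kB[OF k]]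
      po_refl[OF po kB[OF k]]
    unfolding compact_element_def way_below_def by blast
  then obtain \<phi> where \<phi>: "\<And>k. k \<in> K \<Longrightarrow> \<phi> k \<in> \<A>" "\<And>k. k \<in> K \<Longrightarrow> k \<sqsubseteq>\<^bsub>B\<^esub> \<phi> k k" by metis
  have "finite (\<phi> ` K)" "\<phi> ` K \<subseteq> \<A>" using K \<phi> by auto
  from directedD(2)[OF dir this] obtain f where f: "f \<in> \<A>" "\<And>k. k \<in> K \<Longrightarrow> \<phi> k \<sqsubseteq>\<^bsub>scott_maps B B\<^esub> f" by blast
  note fsc = sc[OF f(1)]
  have fle: "f x \<sqsubseteq>\<^bsub>B\<^esub> x" if "x \<in> carrier B" for x
  proof (rule is_lubD(2)[OF _ approximate_identity_pointwise[OF dcpo \<A> that]])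
    show "(\<lambda>f. f x) ` \<A> \<subseteq> carrier B" using scott_continuousD(1)[OF sc] that by auto
  qed (use f in auto)
  have fk: "f k = k" if k: "k \<in> K" for k
  proof (rule po_antisym[OF po fle[OF kB[OF k]] _ scott_continuousD(1)[OF fsc kB[OF k]] kB[OF k]])
    show "k \<sqsubseteq>\<^bsub>B\<^esub> f k"
      by (rule po_trans[OF po \<phi>(2)[OF k]])
        (use f(2)[OF k] kB[OF k] scott_continuousD(1)[OF fsc] scott_continuousD(1)[OF sc[OF \<phi>(1)[OF k]]]
         in \<open>auto simp: scott_maps_le_iff\<close>)
  qed
  obtain M where M: "finite M" "M \<subseteq> carrier B"
    and sep: "\<And>x. x \<in> carrier B \<Longrightarrow> \<exists>m\<in>M. f x \<sqsubseteq>\<^bsub>B\<^esub> m \<and> m \<sqsubseteq>\<^bsub>B\<^esub> x"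
    using fs[OF f(1)] by (auto simp: finitely_separated_def)
  define h where "h = f ^^ (2 * card M + 1)"
  show ?thesis
  proof
    have "h ` carrier B \<subseteq> M"
      unfolding h_def using finitely_separated_iterate_in[OF po scott_continuousD(1)[OF fsc] M sep] by blast
    then show "finite (h ` carrier B)" using M(1) finite_subset by blast
    show "h x \<in> carrier B \<and> h x \<sqsubseteq>\<^bsub>B\<^esub> x" if "x \<in> carrier B" for x
      using iterate_mono[OF fsc that that po_refl[OF po that]] iterate_deflationary[OF po fsc fle that]
      unfolding h_def by blast
    show "h x \<sqsubseteq>\<^bsub>B\<^esub> h y" if "x \<in> carrier B" "y \<in> carrier B" "x \<sqsubseteq>\<^bsub>B\<^esub> y" for x y
      using iterate_mono[OF fsc that] unfolding h_def by blast
    show "h k = k" if "k \<in> K" for k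
    proof -
      have "(f ^^ n) k = k" for n by (induction n) (simp_all add: fk[OF that])
      then show ?thesis unfolding h_def .
    qed
  qed
qed

text \<open>
  It suffices to approximate at the finitely many elements \<open>m\<close> that separate
  \<open>f\<close> from the identity: \<open>f x \<sqsubseteq> m \<sqsubseteq> x\<close> and
  \<open>f m \<sqsubseteq> g m\<close> give \<open>f (f x) \<sqsubseteq> f m \<sqsubseteq> g m
  \<sqsubseteq> g x\<close>.  Since \<open>f m\<close> is way below \<open>m = p (s m)\<close>, it
  is below \<open>p k\<close> for a compact \<open>k \<sqsubseteq> s m\<close>, and
  \<open>g\<close> is the deflation that fixes these compact elements, conjugated by the
  retraction.
\<close>

lemma RB_domain_finite_range_approximation:
  assumes RB: "RB_domain TYPE('b) D" and f: "finitely_separated D f"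
  obtains g where "finite (g ` carrier D)"
    and "\<And>x y. \<lbrakk>x \<in> carrier D; y \<in> carrier D; x \<sqsubseteq>\<^bsub>D\<^esub> y\<rbrakk> \<Longrightarrow> g x \<sqsubseteq>\<^bsub>D\<^esub> g y"
    and "\<And>x. x \<in> carrier D \<Longrightarrow> g x \<sqsubseteq>\<^bsub>D\<^esub> x" "\<And>x. x \<in> carrier D \<Longrightarrow> f (f x) \<sqsubseteq>\<^bsub>D\<^esub> g x"
proof -
  obtain B :: "'b gorder" and s p where D: "dcpo D" and B: "bifinite_domain B"
    and s: "scott_continuous D B s" and p: "scott_continuous B D p"
    and ps: "\<And>x. x \<in> carrier D \<Longrightarrow> p (s x) = x"
    using RB by (auto simp: RB_domain_def)
  note po = dcpo_partial_order[OF D]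
  obtain M where M: "finite M" "M \<subseteq> carrier D"
    and sep: "\<And>x. x \<in> carrier D \<Longrightarrow> \<exists>m\<in>M. f x \<sqsubseteq>\<^bsub>D\<^esub> m \<and> m \<sqsubseteq>\<^bsub>D\<^esub> x"
    and sc: "scott_continuous D D f"
    using f by (auto simp: finitely_separated_def)
  note sB = scott_continuousD(1)[OF s] and pD = scott_continuousD(1)[OF p] and fD = scott_continuousD(1)[OF sc]
  have "\<exists>k. compact_element B k \<and> k \<sqsubseteq>\<^bsub>B\<^esub> s m \<and> f m \<sqsubseteq>\<^bsub>D\<^esub> p k" if "m \<in> M" for m
  proof -
    have mD: "m \<in> carrier D" using that M by auto
    let ?C = "{k. compact_element B k \<and> k \<sqsubseteq>\<^bsub>B\<^esub> s m}"
    have C: "directed B ?C" "is_lub B (s m) ?C"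
      using B sB[OF mD] by (auto simp: bifinite_domain_def algebraic_domain_def)
    have "directed D (p ` ?C)" "is_lub D (p (s m)) (p ` ?C)"
      by (rule directed_scott_image[OF p C(1)], rule scott_continuousD(3)[OF p C])
    moreover have "way_below D (f m) m" by (rule finitely_separated_way_below[OF D f mD])
    ultimately have "\<exists>a\<in>p ` ?C. f m \<sqsubseteq>\<^bsub>D\<^esub> a"
      unfolding way_below_def ps[OF mD] using po_refl[OF po mD] by blast
    then show ?thesis by blast
  qed
  then obtain k where k: "\<And>m. m \<in> M \<Longrightarrow> compact_element B (k m)" "\<And>m. m \<in> M \<Longrightarrow> k m \<sqsubseteq>\<^bsub>B\<^esub> s m"
    "\<And>m. m \<in> M \<Longrightarrow> f m \<sqsubseteq>\<^bsub>D\<^esub> p (k m)" by metis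
  obtain h where h: "finite (h ` carrier B)" "\<And>x. x \<in> carrier B \<Longrightarrow> h x \<in> carrier B \<and> h x \<sqsubseteq>\<^bsub>B\<^esub> x"
    "\<And>x y. \<lbrakk>x \<in> carrier B; y \<in> carrier B; x \<sqsubseteq>\<^bsub>B\<^esub> y\<rbrakk> \<Longrightarrow> h x \<sqsubseteq>\<^bsub>B\<^esub> h y"
    "\<And>c. c \<in> k ` M \<Longrightarrow> h c = c"
  proof (rule bifinite_domain_deflation[OF B, of "k ` M"])
    show "finite (k ` M)" using M(1) by simp
    show "compact_element B c" if "c \<in> k ` M" for c using that k(1) by auto
  qed (rule that)
  define g where "g x = p (h (s x))" for x
  have gD: "g x \<in> carrier D" if "x \<in> carrier D" for x
    unfolding g_def using that sB h(2) pD by blast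
  have gmono: "g x \<sqsubseteq>\<^bsub>D\<^esub> g y" if "x \<in> carrier D" "y \<in> carrier D" "x \<sqsubseteq>\<^bsub>D\<^esub> y" for x y
    unfolding g_def using that sB h(2)
    by (intro scott_continuousD(2)[OF p] h(3) scott_continuousD(2)[OF s]) auto
  show ?thesis
  proof
    have "g ` carrier D \<subseteq> p ` h ` carrier B" using sB by (auto simp: g_def)
    then show "finite (g ` carrier D)" using h(1) finite_subset by blast
    show "g x \<sqsubseteq>\<^bsub>D\<^esub> g y" if "x \<in> carrier D" "y \<in> carrier D" "x \<sqsubseteq>\<^bsub>D\<^esub> y" for x y by (rule gmono[OF that])
    show "g x \<sqsubseteq>\<^bsub>D\<^esub> x" if "x \<in> carrier D" for x
      using scott_continuousD(2)[OF p, of "h (s x)" "s x"] h(2) sB that ps[OF that] by (auto simp: g_def)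
    show "f (f x) \<sqsubseteq>\<^bsub>D\<^esub> g x" if x: "x \<in> carrier D" for x
    proof -
      obtain m where m: "m \<in> M" "f x \<sqsubseteq>\<^bsub>D\<^esub> m" "m \<sqsubseteq>\<^bsub>D\<^esub> x" using sep[OF x] by blast
      have mD: "m \<in> carrier D" using m M by auto
      have kB: "k m \<in> carrier B" using k(1)[OF m(1)] by (simp add: compact_element_def way_below_def)
      have "k m \<sqsubseteq>\<^bsub>B\<^esub> h (s m)" using h(3)[OF kB sB[OF mD] k(2)[OF m(1)]] h(4) m(1) by simp
      then have "p (k m) \<sqsubseteq>\<^bsub>D\<^esub> g m"
        unfolding g_def using kB h(2)[OF sB[OF mD]] by (intro scott_continuousD(2)[OF p]) auto
      then have "f m \<sqsubseteq>\<^bsub>D\<^esub> g m" by (rule po_trans[OF po k(3)[OF m(1)] _ fD[OF mD] pD[OF kB] gD[OF mD]])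
      moreover have "f (f x) \<sqsubseteq>\<^bsub>D\<^esub> f m" by (rule scott_continuousD(2)[OF sc m(2) fD[OF x] mD])
      moreover have "g m \<sqsubseteq>\<^bsub>D\<^esub> g x" by (rule gmono[OF mD x m(3)])
      ultimately have "f (f x) \<sqsubseteq>\<^bsub>D\<^esub> g m" "g m \<sqsubseteq>\<^bsub>D\<^esub> g x"
        using po_trans[OF po _ _ fD[OF fD[OF x]] fD[OF mD] gD[OF mD]] by blast+
      then show ?thesis by (rule po_trans[OF po _ _ fD[OF fD[OF x]] gD[OF mD] gD[OF x]])
    qed
  qed
qed

section \<open>Squares ordered by their four sides\<close>

type_synonym square = "(real \<times> real) \<times> real"

text \<open>
  The positions of the four sides of the square with centre \<open>(x, y)\<close> and half-width
  \<open>r\<close>, with the sign that makes each of them grow when the square shrinks.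
\<close>

definition west :: "square \<Rightarrow> real" where "west = (\<lambda>((x, y), r). x - r)"
definition east :: "square \<Rightarrow> real" where "east = (\<lambda>((x, y), r). - x - r)"
definition south :: "square \<Rightarrow> real" where "south = (\<lambda>((x, y), r). y - r)"
definition north :: "square \<Rightarrow> real" where "north = (\<lambda>((x, y), r). - y - r)"

lemmas sides = west_def east_def south_def north_def

lemma le_Sq_iff:
  "z \<sqsubseteq>\<^bsub>Sq\<^esub> z' \<longleftrightarrow> west z \<le> west z' \<and> east z \<le> east z' \<and> south z \<le> south z' \<and> north z \<le> north z'"
  by (auto simp: Sq_def formal_balls_def d_inf_def sides split: prod.splits)

lemma balance: "west z + east z = south z + north z"
  by (simp add: sides split: prod.splits)

lemma le_Sq_refl: "z \<sqsubseteq>\<^bsub>Sq\<^esub> z"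
  by (simp add: le_Sq_iff)

lemma le_Sq_trans: "u \<sqsubseteq>\<^bsub>Sq\<^esub> v \<Longrightarrow> v \<sqsubseteq>\<^bsub>Sq\<^esub> w \<Longrightarrow> u \<sqsubseteq>\<^bsub>Sq\<^esub> w"
  by (auto simp: le_Sq_iff)

lemma le_Sq_antisym: "u \<sqsubseteq>\<^bsub>Sq\<^esub> v \<Longrightarrow> v \<sqsubseteq>\<^bsub>Sq\<^esub> u \<Longrightarrow> u = v"
  by (auto simp: le_Sq_iff sides split: prod.splits)

lemma sides_radius: "west z + east z = - 2 * snd z" "south z + north z = - 2 * snd z"
  by (simp_all add: sides split: prod.splits)

lemma carrier_Sq: "carrier Sq = ({0..1} \<times> {0..1}) \<times> {0..}"
  by (simp add: Sq_def formal_balls_def)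

lemma carrier_Sq_bot: "carrier Sq_bot = insert None (Some ` carrier Sq)"
  by (simp add: Sq_bot_def adjoin_bottom_def)

lemma le_Sq_bot_simps [simp]:
  "None \<sqsubseteq>\<^bsub>Sq_bot\<^esub> z"
  "\<not> Some a \<sqsubseteq>\<^bsub>Sq_bot\<^esub> None"
  "Some a \<sqsubseteq>\<^bsub>Sq_bot\<^esub> Some b \<longleftrightarrow> a \<sqsubseteq>\<^bsub>Sq\<^esub> b"
  by (simp_all add: Sq_bot_def adjoin_bottom_def)

lemma le_Sq_radius: "z \<sqsubseteq>\<^bsub>Sq\<^esub> z' \<Longrightarrow> snd z' \<le> snd z"
  using sides_radius(1)[of z] sides_radius(1)[of z'] by (simp add: le_Sq_iff)

lemma le_Sq_enlarge: "(c, r + e) \<sqsubseteq>\<^bsub>Sq\<^esub> (c', r' + e) \<longleftrightarrow> (c, r) \<sqsubseteq>\<^bsub>Sq\<^esub> (c', r')"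
  by (simp add: le_Sq_iff sides split: prod.splits)

lemma le_Sq_same_centre: "(c, r) \<sqsubseteq>\<^bsub>Sq\<^esub> (c, r') \<longleftrightarrow> r' \<le> r"
  by (simp add: le_Sq_iff sides split: prod.splits)

lemma partial_order_Sq_bot: "partial_order Sq_bot"
proof
  show "x .=\<^bsub>Sq_bot\<^esub> x" for x by (simp add: Sq_bot_def adjoin_bottom_def)
  show "x .=\<^bsub>Sq_bot\<^esub> y \<Longrightarrow> y .=\<^bsub>Sq_bot\<^esub> x" for x y by (simp add: Sq_bot_def adjoin_bottom_def)
  show "x .=\<^bsub>Sq_bot\<^esub> y \<Longrightarrow> y .=\<^bsub>Sq_bot\<^esub> z \<Longrightarrow> x .=\<^bsub>Sq_bot\<^esub> z" for x y z
    by (simp add: Sq_bot_def adjoin_bottom_def)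
  show "x \<sqsubseteq>\<^bsub>Sq_bot\<^esub> x" for x by (cases x) (simp_all add: le_Sq_refl)
  show "x .=\<^bsub>Sq_bot\<^esub> y" if "x \<sqsubseteq>\<^bsub>Sq_bot\<^esub> y" "y \<sqsubseteq>\<^bsub>Sq_bot\<^esub> x" for x y
  proof -
    have "x = y" using that by (cases x; cases y) (simp_all add: le_Sq_antisym)
    then show ?thesis by (simp add: Sq_bot_def adjoin_bottom_def)
  qed
  show "x \<sqsubseteq>\<^bsub>Sq_bot\<^esub> z" if "x \<sqsubseteq>\<^bsub>Sq_bot\<^esub> y" "y \<sqsubseteq>\<^bsub>Sq_bot\<^esub> z" for x y z
    using that by (cases x; cases y; cases z) (auto intro: le_Sq_trans)
  show "(x \<sqsubseteq>\<^bsub>Sq_bot\<^esub> z) = (y \<sqsubseteq>\<^bsub>Sq_bot\<^esub> w)" if "x .=\<^bsub>Sq_bot\<^esub> y" "z .=\<^bsub>Sq_bot\<^esub> w" for x y z w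
  proof -
    have "x = y" "z = w" using that by (simp_all add: Sq_bot_def adjoin_bottom_def)
    then show ?thesis by simp
  qed
  show "(.=\<^bsub>Sq_bot\<^esub>) = (=)" by (simp add: Sq_bot_def adjoin_bottom_def)
qed

section \<open>The squares form an FS-domain\<close>

text \<open>
  An upper bound whose radius is the infimum of the radii is the supremum: each side of
  \<open>s\<close> exceeds the same side of \<open>a \<sqsubseteq> s\<close> by at most twice the
  difference of the radii.
\<close>

lemma is_lub_Sq_botI:
  assumes A: "A \<subseteq> carrier Sq_bot" and s: "s \<in> carrier Sq"
    and ub: "\<And>a. Some a \<in> A \<Longrightarrow> a \<sqsubseteq>\<^bsub>Sq\<^esub> s"
    and approx: "\<And>\<delta>. \<delta> > 0 \<Longrightarrow> \<exists>a. Some a \<in> A \<and> snd a < snd s + \<delta>"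
  shows "is_lub Sq_bot (Some s) A"
proof (rule is_lubI[OF A])
  show "Some s \<in> carrier Sq_bot" using s by (simp add: carrier_Sq_bot)
  show "a \<sqsubseteq>\<^bsub>Sq_bot\<^esub> Some s" if "a \<in> A" for a using that ub by (cases a) auto
  fix t assume t: "\<And>a. a \<in> A \<Longrightarrow> a \<sqsubseteq>\<^bsub>Sq_bot\<^esub> t"
  obtain b where b: "t = Some b"
    using approx[of 1] t by (cases t) force+
  have "f s \<le> f b" if f: "f \<in> {west, east, south, north}" for f
  proof (rule field_le_epsilon)
    fix \<delta> :: real assume "0 < \<delta>"
    then obtain a where a: "Some a \<in> A" "snd a < snd s + \<delta> / 2" using approx[of "\<delta> / 2"] by auto
    have "a \<sqsubseteq>\<^bsub>Sq\<^esub> b" using t[OF a(1)] b by simp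
    then show "f s \<le> f b + \<delta>"
      using ub[OF a(1)] a(2) f sides_radius[of a] sides_radius[of s] by (auto simp: le_Sq_iff)
  qed
  then show "Some s \<sqsubseteq>\<^bsub>Sq_bot\<^esub> t" by (simp add: b le_Sq_iff)
qed

text \<open>
  Directedness lets the suprema of two opposite sides be approached simultaneously; this is what
  makes the limit of a directed set of squares a square again.
\<close>

lemma Sup_add_Sup_directed:
  fixes p q r :: "'a \<Rightarrow> real"
  assumes ne: "A \<noteq> {}" and sum: "\<And>a. a \<in> A \<Longrightarrow> p a + q a = - 2 * r a"
    and bdd: "\<And>a. a \<in> A \<Longrightarrow> p a \<le> 1" "\<And>a. a \<in> A \<Longrightarrow> q a \<le> 1" "\<And>a. a \<in> A \<Longrightarrow> 0 \<le> r a"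
    and dir: "\<And>a b. a \<in> A \<Longrightarrow> b \<in> A \<Longrightarrow> \<exists>c\<in>A. p a \<le> p c \<and> q b \<le> q c"
  shows "(SUP a\<in>A. p a) + (SUP a\<in>A. q a) = - 2 * (INF a\<in>A. r a)"
proof (rule antisym)
  define P Q R where "P = (SUP a\<in>A. p a)" and "Q = (SUP a\<in>A. q a)" and "R = (INF a\<in>A. r a)"
  have P: "p a \<le> P" and Q: "q a \<le> Q" and R: "R \<le> r a" if "a \<in> A" for a
    unfolding P_def Q_def R_def using bdd
    by (auto intro!: cSUP_upper cINF_lower that bdd_aboveI2 bdd_belowI2)
  have "p a + q b \<le> - 2 * R" if ab: "a \<in> A" "b \<in> A" for a b
  proof -
    obtain c where "c \<in> A" "p a \<le> p c" "q b \<le> q c" using dir ab by blast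
    then show ?thesis using sum[of c] R[of c] by linarith
  qed
  then have "P \<le> - 2 * R - q b" if "b \<in> A" for b
    unfolding P_def by (intro cSUP_least[OF ne]) (use that in force)
  then have "Q \<le> - 2 * R - P"
    unfolding Q_def by (intro cSUP_least[OF ne]) force
  then show "(SUP a\<in>A. p a) + (SUP a\<in>A. q a) \<le> - 2 * (INF a\<in>A. r a)"
    by (simp add: P_def Q_def R_def)
  have "(- P - Q) / 2 \<le> r c" if "c \<in> A" for c
  proof -
    have "- 2 * r c \<le> P + Q" using sum[OF that] P[OF that] Q[OF that] by linarith
    then show ?thesis by (simp add: field_simps)
  qed
  then have "(- P - Q) / 2 \<le> R" unfolding R_def by (rule cINF_greatest[OF ne])
  then show "- 2 * (INF a\<in>A. r a) \<le> (SUP a\<in>A. p a) + (SUP a\<in>A. q a)"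
    unfolding P_def Q_def R_def by (simp add: field_simps)
qed

lemma directed_Sq_bot_limit:
  assumes A: "directed Sq_bot A" and ne: "Some a\<^sub>0 \<in> A"
  obtains s where "s \<in> carrier Sq" "\<And>a. Some a \<in> A \<Longrightarrow> a \<sqsubseteq>\<^bsub>Sq\<^esub> s"
    and "\<And>\<delta>. \<delta> > 0 \<Longrightarrow> \<exists>a. Some a \<in> A \<and> snd a < snd s + \<delta>"
proof -
  define A' where "A' = {a. Some a \<in> A}"
  have ne': "A' \<noteq> {}" using ne unfolding A'_def by blast
  have in_Sq: "a \<in> carrier Sq" if "a \<in> A'" for a
    using directedD(1)[OF A] that by (auto simp: A'_def carrier_Sq_bot)
  have bdd: "west a \<le> 1" "east a \<le> 1" "south a \<le> 1" "north a \<le> 1" "0 \<le> snd a" if "a \<in> A'" for a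
    using in_Sq[OF that] by (auto simp: carrier_Sq sides)
  have dir: "\<exists>c\<in>A'. a \<sqsubseteq>\<^bsub>Sq\<^esub> c \<and> b \<sqsubseteq>\<^bsub>Sq\<^esub> c" if "a \<in> A'" "b \<in> A'" for a b
  proof -
    obtain c where "c \<in> A" "Some a \<sqsubseteq>\<^bsub>Sq_bot\<^esub> c" "Some b \<sqsubseteq>\<^bsub>Sq_bot\<^esub> c"
      using directedD(2)[OF A, of "{Some a, Some b}"] \<open>a \<in> A'\<close> \<open>b \<in> A'\<close> by (auto simp: A'_def)
    then show ?thesis by (cases c) (auto simp: A'_def)
  qed
  define W E S N R where "W = (SUP a\<in>A'. west a)" and "E = (SUP a\<in>A'. east a)"
    and "S = (SUP a\<in>A'. south a)" and "N = (SUP a\<in>A'. north a)" and "R = (INF a\<in>A'. snd a)"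
  have WE: "W + E = - 2 * R" unfolding W_def E_def R_def
    by (rule Sup_add_Sup_directed[OF ne'])
      (use dir bdd sides_radius in \<open>auto simp: le_Sq_iff, meson\<close>)
  have SN: "S + N = - 2 * R" unfolding S_def N_def R_def
    by (rule Sup_add_Sup_directed[OF ne'])
      (use dir bdd sides_radius in \<open>auto simp: le_Sq_iff, meson\<close>)
  have ub: "west a \<le> W" "east a \<le> E" "south a \<le> S" "north a \<le> N" if "a \<in> A'" for a
    unfolding W_def E_def S_def N_def
    by (rule cSUP_upper[OF that bdd_aboveI2], erule bdd)+
  have approx: "\<exists>a\<in>A'. snd a < R + \<delta>" if "\<delta> > 0" for \<delta>
  proof -
    have "bdd_below (snd ` A')" by (rule bdd_belowI2[of _ 0], erule bdd)
    then show ?thesis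
      using that cINF_less_iff[OF ne', of snd "R + \<delta>"] by (simp add: R_def)
  qed
  define s :: square where "s = (((W - E) / 2, (S - N) / 2), R)"
  have s: "west s = W" "east s = E" "south s = S" "north s = N"
    using WE SN by (simp_all add: s_def sides field_simps)
  have centre: "- \<delta> \<le> (W - E) / 2 \<and> (W - E) / 2 \<le> 1 + \<delta> \<and> - \<delta> \<le> (S - N) / 2 \<and> (S - N) / 2 \<le> 1 + \<delta>"
    if \<delta>: "\<delta> > 0" for \<delta>
  proof -
    obtain a where a: "a \<in> A'" "snd a < R + \<delta>" using approx[OF \<delta>] by blast
    obtain x y r where xyr: "a = ((x, y), r)" by (metis surj_pair)
    have "0 \<le> x" "x \<le> 1" "0 \<le> y" "y \<le> 1" "r < R + \<delta>" "x - r \<le> W" "- x - r \<le> E" "y - r \<le> S" "- y - r \<le> N"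
      using in_Sq[OF a(1)] a(2) ub[OF a(1)] by (auto simp: xyr carrier_Sq sides)
    then show ?thesis using WE SN by (auto simp: field_simps)
  qed
  have "0 \<le> (W - E) / 2" "(W - E) / 2 \<le> 1" "0 \<le> (S - N) / 2" "(S - N) / 2 \<le> 1"
    by - (rule field_le_epsilon, drule centre, linarith)+
  moreover have "0 \<le> R" unfolding R_def by (rule cINF_greatest[OF ne']) (rule bdd)
  ultimately have "s \<in> carrier Sq" by (simp add: s_def carrier_Sq)
  moreover have "a \<sqsubseteq>\<^bsub>Sq\<^esub> s" if "Some a \<in> A" for a
    using ub[of a] that by (simp add: le_Sq_iff s A'_def)
  moreover have "\<exists>a. Some a \<in> A \<and> snd a < snd s + \<delta>" if "\<delta> > 0" for \<delta>
    using approx[OF that] by (auto simp: s_def A'_def)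
  ultimately show ?thesis by (rule that)
qed

lemma directed_Sq_bot_cases:
  assumes "directed Sq_bot A"
  obtains "A = {None}" | a where "Some a \<in> A"
  using directed_nonempty[OF assms] by (metis is_singletonI' is_singleton_the_elem not_Some_eq singletonI)

lemma is_lub_None: "is_lub Sq_bot None {None}"
  by (rule is_lubI) (auto simp: carrier_Sq_bot)

lemma dcpo_Sq_bot: "dcpo Sq_bot"
  unfolding dcpo_def
proof (intro conjI partial_order_Sq_bot allI impI)
  fix A assume A: "directed Sq_bot A"
  from A show "\<exists>s. is_lub Sq_bot s A"
  proof (cases rule: directed_Sq_bot_cases)
    case 1 then show ?thesis using is_lub_None by auto
  next
    case (2 a)
    from directed_Sq_bot_limit[OF A 2] show ?thesis
      using is_lub_Sq_botI[OF directedD(1)[OF A]] by metis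
  qed
qed

lemma pointed_dcpo_Sq_bot: "pointed_dcpo Sq_bot"
proof -
  have "least Sq_bot None (carrier Sq_bot)" by (auto simp: least_def carrier_Sq_bot)
  then show ?thesis using dcpo_Sq_bot by (auto simp: pointed_dcpo_def)
qed

lemma is_lub_Sq_bot_radius:
  assumes A: "directed Sq_bot A" and lub: "is_lub Sq_bot (Some s) A" and \<delta>: "\<delta> > 0"
  shows "\<exists>a. Some a \<in> A \<and> snd a < snd s + \<delta>"
  using A
proof (cases rule: directed_Sq_bot_cases)
  case 1
  then have "Some s \<sqsubseteq>\<^bsub>Sq_bot\<^esub> None"
    using is_lubD(3)[OF directedD(1)[OF A] lub, of None] by (auto simp: carrier_Sq_bot)
  then show ?thesis by simp
next
  case (2 a)
  obtain s' where s': "s' \<in> carrier Sq" "\<And>a. Some a \<in> A \<Longrightarrow> a \<sqsubseteq>\<^bsub>Sq\<^esub> s'"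
    "\<And>\<delta>. \<delta> > 0 \<Longrightarrow> \<exists>a. Some a \<in> A \<and> snd a < snd s' + \<delta>"
    using directed_Sq_bot_limit[OF A 2] by metis
  have "is_lub Sq_bot (Some s') A" by (rule is_lub_Sq_botI[OF directedD(1)[OF A] s'])
  then have "s = s'"
    using partial_order.least_unique[OF partial_order_Sq_bot lub, of "Some s'"] by simp
  then show ?thesis using s'(3) \<delta> by blast
qed

text \<open>
  The cut-off at radius \<open>n\<close> is what allows a finite separating set although radii are
  unbounded.
\<close>

definition enlarge :: "nat \<Rightarrow> square option \<Rightarrow> square option" where
  "enlarge n = (\<lambda>z\<in>carrier Sq_bot. case z of None \<Rightarrow> None
     | Some (c, r) \<Rightarrow> if r < n then Some (c, r + 1 / n) else None)"

lemma enlarge_simps: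
  "enlarge n None = None"
  "(c, r) \<in> carrier Sq \<Longrightarrow> enlarge n (Some (c, r)) = (if r < n then Some (c, r + 1 / n) else None)"
  by (simp_all add: enlarge_def carrier_Sq_bot)

lemma carrier_Sq_botE:
  assumes "z \<in> carrier Sq_bot"
  obtains "z = None" | c r where "z = Some (c, r)" "(c, r) \<in> carrier Sq"
  using assms by (auto simp: carrier_Sq_bot)

lemma enlarge_in_carrier: "z \<in> carrier Sq_bot \<Longrightarrow> enlarge n z \<in> carrier Sq_bot"
  by (erule carrier_Sq_botE) (auto simp: enlarge_simps carrier_Sq_bot carrier_Sq)

lemma enlarge_mono:
  assumes "z \<in> carrier Sq_bot" "z' \<in> carrier Sq_bot" "z \<sqsubseteq>\<^bsub>Sq_bot\<^esub> z'"
  shows "enlarge n z \<sqsubseteq>\<^bsub>Sq_bot\<^esub> enlarge n z'"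
  using assms(1)
proof (cases rule: carrier_Sq_botE)
  case (2 c r)
  with assms obtain c' r' where z': "z' = Some (c', r')" "(c', r') \<in> carrier Sq"
    by (auto simp: carrier_Sq_bot)
  with 2 assms show ?thesis
    using le_Sq_radius[of "(c, r)" "(c', r')"] by (auto simp: enlarge_simps le_Sq_enlarge)
qed (simp add: enlarge_simps)

lemma enlarge_le:
  assumes "z \<in> carrier Sq_bot"
  shows "enlarge n z \<sqsubseteq>\<^bsub>Sq_bot\<^esub> z"
  using assms by (cases rule: carrier_Sq_botE) (auto simp: enlarge_simps le_Sq_same_centre)

lemma enlarge_le_enlarge:
  assumes "z \<in> carrier Sq_bot" "0 < m" "m \<le> n"
  shows "enlarge m z \<sqsubseteq>\<^bsub>Sq_bot\<^esub> enlarge n z"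
  using assms(1)
proof (cases rule: carrier_Sq_botE)
  case (2 c r)
  have "1 / real n \<le> 1 / real m" using assms by (simp add: frac_le)
  then show ?thesis using 2 assms by (auto simp: enlarge_simps le_Sq_same_centre)
qed (simp add: enlarge_simps)

text \<open>
  Suprema are detected by the infimum of the radii, which the shift by \<open>1/n\<close>
  respects, and the condition \<open>r < n\<close> is an open one.
\<close>

lemma scott_continuous_enlarge: "scott_continuous Sq_bot Sq_bot (enlarge n)"
  unfolding scott_continuous_def isotone_def
proof (intro conjI allI impI ballI)
  fix A s assume "directed Sq_bot A \<and> is_lub Sq_bot s A"
  then have A: "directed Sq_bot A" and lub: "is_lub Sq_bot s A" by auto
  note AD = directedD(1)[OF A]
  have sD: "s \<in> carrier Sq_bot" by (rule is_lubD(1)[OF AD lub])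
  have img: "enlarge n ` A \<subseteq> carrier Sq_bot" using AD enlarge_in_carrier by auto
  have ub: "enlarge n a \<sqsubseteq>\<^bsub>Sq_bot\<^esub> enlarge n s" if "a \<in> A" for a
    using that AD sD is_lubD(2)[OF AD lub] by (intro enlarge_mono) auto
  show "is_lub Sq_bot (enlarge n s) (enlarge n ` A)"
  proof (cases "enlarge n s")
    case None
    have "enlarge n a = None" if "a \<in> A" for a
      using ub[OF that] None by (cases "enlarge n a") auto
    then have "enlarge n ` A = {None}" using directed_nonempty[OF A] by auto
    then show ?thesis using None is_lub_None by simp
  next
    case (Some t)
    have "s \<noteq> None" by (rule notI) (use Some in \<open>simp add: enlarge_simps\<close>)
    then obtain c r where cr: "s = Some (c, r)" "(c, r) \<in> carrier Sq" using sD by (blast elim: carrier_Sq_botE)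
    then have s: "s = Some (c, r)" "(c, r) \<in> carrier Sq" "r < n" "t = (c, r + 1 / n)"
      using Some by (simp_all add: enlarge_simps split: if_splits)
    show ?thesis unfolding Some
    proof (rule is_lub_Sq_botI[OF img])
      show "t \<in> carrier Sq" using enlarge_in_carrier[OF sD, of n] Some by (auto simp: carrier_Sq_bot)
      show "b \<sqsubseteq>\<^bsub>Sq\<^esub> t" if "Some b \<in> enlarge n ` A" for b
        using that ub Some by (metis imageE le_Sq_bot_simps(3))
      fix \<delta> :: real assume "\<delta> > 0"
      \<comment> \<open>The bound \<open>n - r\<close> ensures that the approximating squares are not sent to
          \<open>\<bottom>\<close>.\<close>
      then have "min \<delta> (n - r) > 0" using s by simp
      from is_lub_Sq_bot_radius[OF A lub[unfolded s(1)] this]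
      obtain c' r' where a: "Some (c', r') \<in> A" "r' < r + \<delta>" "r' < n" by auto
      then have "(c', r') \<in> carrier Sq" using AD by (auto simp: carrier_Sq_bot)
      then have "Some (c', r' + 1 / n) \<in> enlarge n ` A" using a by (intro image_eqI[of _ _ "Some (c', r')"]) (simp_all add: enlarge_simps)
      then show "\<exists>b. Some b \<in> enlarge n ` A \<and> snd b < snd t + \<delta>"
        using a s by (intro exI[of _ "(c', r' + 1 / n)"]) simp
    qed
  qed
qed (use enlarge_in_carrier enlarge_mono partial_order_weak[OF partial_order_Sq_bot] in auto)

lemma finitely_separated_enlarge:
  assumes n: "0 < n"
  shows "finitely_separated Sq_bot (enlarge n)"
  unfolding finitely_separated_def
proof (intro conjI scott_continuous_enlarge)
  define p :: "nat \<Rightarrow> real" where "p i = i / (4 * n)" for i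
  define M where "M = insert None (Some ` ((p ` {..4 * n} \<times> p ` {..4 * n}) \<times> p ` {..4 * n * n + 2}))"
  have grid: "\<exists>i. p i \<le> x \<and> x < p i + 1 / (4 * n) \<and> i \<le> 4 * n * m" if "0 \<le> x" "x \<le> real m" for x m
  proof -
    let ?i = "nat \<lfloor>x * (4 * n)\<rfloor>"
    have i: "real ?i \<le> x * (4 * n)" "x * (4 * n) < real ?i + 1"
      using that by (auto simp: of_nat_nat)
    have "x * (4 * n) \<le> real m * (4 * n)" using that by (intro mult_right_mono) auto
    then have "real ?i \<le> real (4 * n * m)" using i(1) by (simp add: mult.commute)
    then have "?i \<le> 4 * n * m" by (simp only: of_nat_le_iff)
    then show ?thesis using i n by (intro exI[of _ ?i]) (simp add: p_def field_simps)
  qed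
  have p01: "p i \<in> {0..1}" if "i \<le> 4 * n" for i
    using that n by (simp add: p_def field_simps flip: of_nat_mult)
  have "finite M" by (simp add: M_def)
  moreover have "M \<subseteq> carrier Sq_bot"
    unfolding M_def carrier_Sq_bot carrier_Sq using p01 by (auto simp: p_def)
  moreover have "\<exists>m\<in>M. enlarge n z \<sqsubseteq>\<^bsub>Sq_bot\<^esub> m \<and> m \<sqsubseteq>\<^bsub>Sq_bot\<^esub> z" if z: "z \<in> carrier Sq_bot" for z
  proof (cases "enlarge n z")
    case None then show ?thesis by (auto simp: M_def)
  next
    case (Some t)
    have "z \<noteq> None" by (rule notI) (use Some in \<open>simp add: enlarge_simps\<close>)
    then obtain c r where cr: "z = Some (c, r)" "(c, r) \<in> carrier Sq" using z by (blast elim: carrier_Sq_botE)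
    obtain x y where c: "c = (x, y)" by (rule prod.exhaust)
    have s: "z = Some ((x, y), r)" "((x, y), r) \<in> carrier Sq" "r < n" "t = ((x, y), r + 1 / n)"
      using cr Some by (simp_all add: c enlarge_simps split: if_splits)
    obtain i where i: "p i \<le> x" "x < p i + 1 / (4 * n)" "i \<le> 4 * n" using grid[of x 1] s by (auto simp: carrier_Sq)
    obtain j where j: "p j \<le> y" "y < p j + 1 / (4 * n)" "j \<le> 4 * n" using grid[of y 1] s by (auto simp: carrier_Sq)
    obtain k where k: "p k \<le> r" "r < p k + 1 / (4 * n)" "k \<le> 4 * n * n" using grid[of r n] s by (auto simp: carrier_Sq)
    have p2: "p (k + 2) = p k + 2 * (1 / (4 * n))" by (simp add: p_def add_divide_distrib)
    have n4: "1 / real n = 4 * (1 / (4 * n))" by simp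
    \<comment> \<open>Rounding the centre moves it by less than \<open>1/(4n)\<close>, so the radius of the
        separating square has to exceed \<open>r\<close> by at least that much and stay below
        \<open>r + 3/(4n)\<close>.  Rounding down and adding two mesh widths does this.\<close>
    let ?m = "((p i, p j), p (k + 2))"
    have "t \<sqsubseteq>\<^bsub>Sq\<^esub> ?m" "?m \<sqsubseteq>\<^bsub>Sq\<^esub> ((x, y), r)"
      using i j k unfolding s(4) le_Sq_iff sides p2 n4 by auto
    moreover have "Some ?m \<in> M" using i j k by (auto simp: M_def)
    ultimately show ?thesis using Some s(1) by (intro bexI[of _ "Some ?m"]) auto
  qed
  ultimately show "\<exists>M. finite M \<and> M \<subseteq> carrier Sq_bot \<and>
      (\<forall>z\<in>carrier Sq_bot. \<exists>m\<in>M. enlarge n z \<sqsubseteq>\<^bsub>Sq_bot\<^esub> m \<and> m \<sqsubseteq>\<^bsub>Sq_bot\<^esub> z)" by blast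
qed

lemma is_lub_enlarge:
  assumes z: "z \<in> carrier Sq_bot"
  shows "is_lub Sq_bot z ((\<lambda>n. enlarge n z) ` {0<..})"
  using z
proof (cases rule: carrier_Sq_botE)
  case 1
  have "(\<lambda>n. enlarge n None) ` {0<..} = {None}" by (auto simp: enlarge_simps)
  then show ?thesis using 1 is_lub_None by simp
next
  case (2 c r)
  show ?thesis unfolding 2(1)
  proof (rule is_lub_Sq_botI)
    show "(\<lambda>n. enlarge n (Some (c, r))) ` {0<..} \<subseteq> carrier Sq_bot"
      using enlarge_in_carrier z 2(1) by blast
    show "(c, r) \<in> carrier Sq" by (rule 2)
    show "a \<sqsubseteq>\<^bsub>Sq\<^esub> (c, r)" if "Some a \<in> (\<lambda>n. enlarge n (Some (c, r))) ` {0<..}" for a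
    proof -
      from that obtain n where "Some a = enlarge n (Some (c, r))" by blast
      then show ?thesis using enlarge_le[OF z, of n] unfolding 2(1) by (metis le_Sq_bot_simps(3))
    qed
    fix \<delta> :: real assume \<delta>: "\<delta> > 0"
    obtain n :: nat where n: "max r (1 / \<delta>) < n" using reals_Archimedean2 by blast
    have "0 < 1 / \<delta>" using \<delta> by simp
    then have n0: "0 < real n" using n by linarith
    moreover have "1 / n < \<delta>" using n n0 \<delta> by (simp add: field_simps)
    ultimately have "0 < n" "1 / n < \<delta>" by auto
    then show "\<exists>a. Some a \<in> (\<lambda>n. enlarge n (Some (c, r))) ` {0<..} \<and> snd a < snd (c, r) + \<delta>"
      using n 2(2) by (intro exI[of _ "(c, r + 1 / n)"] conjI image_eqI[of _ _ n]) (auto simp: enlarge_simps)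
  qed
qed

lemma FS_domain_Sq_bot: "FS_domain Sq_bot"
  unfolding FS_domain_def
proof (intro conjI pointed_dcpo_Sq_bot exI[of _ "enlarge ` {0<..}"] ballI)
  let ?\<A> = "enlarge ` {0<..}"
  let ?S = "scott_maps Sq_bot Sq_bot"
  have ext: "enlarge n \<in> extensional (carrier Sq_bot)" for n by (simp add: enlarge_def)
  have sub: "?\<A> \<subseteq> carrier ?S"
    using scott_continuous_enlarge ext by (auto simp: scott_maps_carrier_iff)
  have "directed ?S ?\<A>" unfolding directed_def
  proof (intro conjI sub allI impI)
    fix F assume "finite F \<and> F \<subseteq> ?\<A>"
    then obtain I where I: "I \<subseteq> {0<..}" "finite I" "F = enlarge ` I" by (meson finite_subset_image)
    have "n \<le> Max (insert 1 I)" "0 < n" if "n \<in> I" for n using I that by auto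
    then have "\<forall>f\<in>F. f \<sqsubseteq>\<^bsub>?S\<^esub> enlarge (Max (insert 1 I))"
      unfolding I(3) scott_maps_le_iff using enlarge_le_enlarge by blast
    moreover have "0 < Max (insert 1 I)" using I(2) by (simp add: Max_gr_iff)
    ultimately show "\<exists>a\<in>?\<A>. \<forall>f\<in>F. f \<sqsubseteq>\<^bsub>?S\<^esub> a" by blast
  qed
  moreover have "is_lub ?S (\<lambda>z\<in>carrier Sq_bot. z) ?\<A>"
  proof (rule is_lubI[OF sub])
    have img: "(\<lambda>f. f z) ` ?\<A> = (\<lambda>n. enlarge n z) ` {0<..}" for z by auto
    have "scott_continuous Sq_bot Sq_bot (\<lambda>z\<in>carrier Sq_bot. z)"
      by (rule scott_continuous_pointwise_lub[OF partial_order_Sq_bot partial_order_Sq_bot, where \<A> = ?\<A>])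
        (use scott_continuous_enlarge is_lub_enlarge in \<open>auto simp: img\<close>)
    then show "(\<lambda>z\<in>carrier Sq_bot. z) \<in> carrier ?S" by (simp add: scott_maps_carrier_iff)
    show "f \<sqsubseteq>\<^bsub>?S\<^esub> (\<lambda>z\<in>carrier Sq_bot. z)" if "f \<in> ?\<A>" for f
      using that enlarge_le by (auto simp: scott_maps_le_iff)
    fix t assume t: "t \<in> carrier ?S" "\<And>f. f \<in> ?\<A> \<Longrightarrow> f \<sqsubseteq>\<^bsub>?S\<^esub> t"
    have "z \<sqsubseteq>\<^bsub>Sq_bot\<^esub> t z" if z: "z \<in> carrier Sq_bot" for z
    proof (rule is_lubD(3)[OF _ is_lub_enlarge[OF z]])
      show "(\<lambda>n. enlarge n z) ` {0<..} \<subseteq> carrier Sq_bot" using enlarge_in_carrier[OF z] by auto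
      show "t z \<in> carrier Sq_bot" using t(1) z by (auto simp: scott_maps_carrier_iff dest: scott_continuousD(1))
      show "a \<sqsubseteq>\<^bsub>Sq_bot\<^esub> t z" if "a \<in> (\<lambda>n. enlarge n z) ` {0<..}" for a
        using that t(2) z by (auto simp: scott_maps_le_iff)
    qed
    then show "(\<lambda>z\<in>carrier Sq_bot. z) \<sqsubseteq>\<^bsub>?S\<^esub> t" by (auto simp: scott_maps_le_iff)
  qed
  ultimately show "approximate_identity Sq_bot ?\<A>" by (simp add: approximate_identity_def)
qed (use finitely_separated_enlarge in auto)

section \<open>Shifted sums and dyadic scales\<close>

lemma sum_shift_telescope:
  fixes F :: "int \<Rightarrow> real"
  assumes "0 \<le> s" "0 \<le> N"
  shows "(\<Sum>i\<in>{0..<N}. F (i + s) - F i) = (\<Sum>i\<in>{0..<s}. F (i + N) - F i)"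
proof -
  have shift: "(\<Sum>i\<in>{0..<n}. F (i + m)) = (\<Sum>i\<in>{m..<m+n}. F i)" for n m :: int
    by (rule sum.reindex_bij_witness[of _ "\<lambda>i. i - m" "\<lambda>i. i + m"]) auto
  have split: "(\<Sum>i\<in>{0..<m}. F i) + (\<Sum>i\<in>{m..<m+n}. F i) = (\<Sum>i\<in>{0..<m+n}. F i)"
    if "0 \<le> m" "0 \<le> n" for m n :: int
  proof -
    have "{0..<m+n} = {0..<m} \<union> {m..<m+n}" using that by auto
    then show ?thesis by (simp add: sum.union_disjoint)
  qed
  show ?thesis
    using split[OF assms] split[OF assms(2,1)]
    by (simp add: sum_subtractf shift add.commute)
qed

lemma sum_shift_le:
  fixes F :: "int \<Rightarrow> real"
  assumes "0 \<le> s" "0 \<le> N" "\<And>i. i \<in> {0..<s} \<Longrightarrow> F (i + N) - F i \<le> c"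
  shows "(\<Sum>i\<in>{0..<N}. F (i + s) - F i) \<le> s * c"
  using sum_bounded_above[of "{0..<s}" "\<lambda>i. F (i + N) - F i" c] assms
  by (simp add: sum_shift_telescope)

lemma sum_shift_ge:
  fixes F :: "int \<Rightarrow> real"
  assumes "0 \<le> s" "0 \<le> N" "\<And>i. i \<in> {0..<s} \<Longrightarrow> c \<le> F (i + N) - F i"
  shows "s * c \<le> (\<Sum>i\<in>{0..<N}. F (i + s) - F i)"
  using sum_bounded_below[of "{0..<s}" c "\<lambda>i. F (i + N) - F i"] assms
  by (simp add: sum_shift_telescope)

text \<open>
  A geometric series that starts at the first scale beyond \<open>d/2\<close>, where its term is
  below \<open>2\<close>.
\<close>

lemma sum_dyadic_tail_le:
  fixes d :: real
  assumes "0 < d"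
  shows "(\<Sum>l<K. if d < 2 * 2 ^ l then d / 2 ^ l else 0) \<le> 4"
proof -
  \<comment> \<open>The subtracted term \<open>2 d / 2\<^sup>K\<close> is the remainder of the geometric
      series, which makes the induction work.\<close>
  have "(\<Sum>l<K. if d < 2 * 2 ^ l then d / 2 ^ l else 0) \<le> (if d < 2 ^ K then 4 - 2 * d / 2 ^ K else 0)"
  proof (induction K)
    case (Suc K)
    have "d / 2 ^ K < 2" if "d < 2 * 2 ^ K" using that by (simp add: field_simps)
    moreover have "d < 2 ^ K \<Longrightarrow> d < 2 * 2 ^ K" using assms by linarith
    ultimately show ?case using Suc by (auto split: if_splits)
  qed (use assms in auto)
  also have "\<dots> \<le> 4" using assms by simp
  finally show ?thesis .
qed

text \<open>
  Let \<open>A\<close> hold from \<open>a\<close> on and \<open>B\<close> from \<open>b\<close>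
  on.  A point of \<open>X s\<close> lies in \<open>{a..<b}\<close>, and both thresholds are
  within \<open>s\<close> of it.  So \<open>X s\<close> has at most \<open>d = b - a\<close>
  points, and none unless \<open>d < 2 s\<close>.
\<close>

lemma sum_dyadic_crossings_le:
  fixes A B :: "int \<Rightarrow> bool"
  assumes A: "\<And>t t'. lo \<le> t \<Longrightarrow> t \<le> t' \<Longrightarrow> t' \<le> hi \<Longrightarrow> A t \<Longrightarrow> A t'"
    and B: "\<And>t t'. lo \<le> t \<Longrightarrow> t \<le> t' \<Longrightarrow> t' \<le> hi \<Longrightarrow> B t \<Longrightarrow> B t'"
  defines "X \<equiv> \<lambda>s. {t. lo \<le> t - s \<and> t + s \<le> hi \<and> A t \<and> \<not> B t \<and> \<not> A (t - s) \<and> B (t + s)}"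
  shows "(\<Sum>l<K. real (card (X (2 ^ l))) / 2 ^ l) \<le> 4"
proof (cases "\<exists>l<K. X (2 ^ l) \<noteq> {}")
  case True
  then obtain l t where t: "t \<in> X (2 ^ l)" by auto
  define a where "a = Min {t \<in> {lo..hi}. A t}"
  define b where "b = Min {t \<in> {lo..hi}. B t}"
  have p: "(0::int) < 2 ^ l" by simp
  have neA: "t \<in> {t \<in> {lo..hi}. A t}" and neB: "t + 2 ^ l \<in> {t \<in> {lo..hi}. B t}"
  proof -
    have "lo \<le> t - 2 ^ l" "t + 2 ^ l \<le> hi" "A t" "B (t + 2 ^ l)" using t by (auto simp: X_def)
    moreover from this p have "lo \<le> t" "t \<le> hi" "lo \<le> t + 2 ^ l" by linarith+
    ultimately show "t \<in> {t \<in> {lo..hi}. A t}" "t + 2 ^ l \<in> {t \<in> {lo..hi}. B t}" by auto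
  qed
  have fin: "finite {t \<in> {lo..hi}. P t}" for P
    by (rule finite_subset[of _ "{lo..hi}"]) auto
  have a: "a \<in> {lo..hi}" "A a" and b: "b \<in> {lo..hi}" "B b"
    using Min_in[OF fin, of A] Min_in[OF fin, of B] neA neB unfolding a_def b_def by blast+
  have amin: "a \<le> u" if "A u" "u \<in> {lo..hi}" for u
    unfolding a_def by (rule Min_le[OF fin]) (use that in auto)
  have bmin: "b \<le> u" if "B u" "u \<in> {lo..hi}" for u
    unfolding b_def by (rule Min_le[OF fin]) (use that in auto)
  have key: "a \<le> u \<and> u < b \<and> b - a < 2 * s" if "u \<in> X s" "0 < s" for u s
  proof -
    have "a \<le> u" using that by (intro amin) (auto simp: X_def)
    moreover have "u < b" using that B[of b u] b by (force simp: X_def)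
    moreover have "u - s < a" using that A[of a "u - s"] a by (force simp: X_def)
    moreover have "b \<le> u + s" using that by (intro bmin) (auto simp: X_def)
    ultimately show ?thesis by linarith
  qed
  define d where "d = real_of_int (b - a)"
  have d: "0 < d" using key[OF t p] by (simp add: d_def)
  have "real (card (X (2 ^ m))) / 2 ^ m \<le> (if d < 2 * 2 ^ m then d / 2 ^ m else 0)" for m
  proof (cases "X (2 ^ m) = {}")
    case False
    then obtain u where "u \<in> X (2 ^ m)" by auto
    from key[OF this] have "b - a < 2 * 2 ^ m" by simp
    then have "real_of_int (b - a) < real_of_int (2 * 2 ^ m)" by (rule of_int_less_iff[THEN iffD2])
    then have "d < 2 * 2 ^ m" by (simp add: d_def)
    moreover have "X (2 ^ m) \<subseteq> {a..<b}" using key by auto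
    then have "card (X (2 ^ m)) \<le> nat (b - a)"
      by (metis card_atLeastLessThan_int card_mono finite_atLeastLessThan_int)
    then have "real (card (X (2 ^ m))) \<le> d" using d by (simp add: d_def le_nat_iff)
    ultimately show ?thesis by (simp add: divide_right_mono)
  qed (use d in auto)
  then have "(\<Sum>l<K. real (card (X (2 ^ l))) / 2 ^ l) \<le> (\<Sum>l<K. if d < 2 * 2 ^ l then d / 2 ^ l else 0)"
    by (rule sum_mono)
  then show ?thesis using sum_dyadic_tail_le[OF d, of K] by linarith
qed auto

section \<open>No monotone rounding of squares has finite range\<close>

definition small_squares :: "square set" where
  "small_squares = ({0..1} \<times> {0..1}) \<times> {0..<2}"

text \<open>
  A lattice of squares whose three unit steps are extreme directions of the order: each of them
  fixes one corner of the square, hence two sides, and moves the other two sides.  The first step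
  moves west and south, the second west and north, the third east and south.  The fourth such
  direction, moving east and north, is second plus third minus first.  The mesh \<open>1/(16
  N)\<close> keeps all squares with indices in \<open>{-N..3*N}\<close> admissible.
\<close>

definition node :: "int \<Rightarrow> int \<Rightarrow> int \<Rightarrow> int \<Rightarrow> square" where
  "node N i j k = ((1/2 + (i + j - k) / (16 * N), 1/2 + (i - j + k) / (16 * N)), 1 - (i + j + k) / (16 * N))"

lemma sides_node:
  assumes "N > 0"
  shows "west (node N i j k) = - 1/2 + (i + j) / (8 * N)"
    and "east (node N i j k) = - 3/2 + k / (8 * N)"
    and "south (node N i j k) = - 1/2 + (i + k) / (8 * N)"
    and "north (node N i j k) = - 3/2 + j / (8 * N)"
  using assms by (auto simp: node_def sides field_simps)

lemma node_le:
  assumes "N > 0" "i + j \<le> i' + j'" "k \<le> k'" "i + k \<le> i' + k'" "j \<le> j'"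
  shows "node N i j k \<sqsubseteq>\<^bsub>Sq\<^esub> node N i' j' k'"
proof -
  have "real_of_int i + j \<le> i' + j'" "real_of_int k \<le> k'" "real_of_int i + k \<le> i' + k'" "real_of_int j \<le> j'"
    using assms by linarith+
  then show ?thesis
    unfolding le_Sq_iff sides_node[OF assms(1)] using assms(1) by (simp add: divide_right_mono)
qed

lemma node_in_small_squares:
  assumes "N > 0" "i \<in> {-N..3*N}" "j \<in> {-N..3*N}" "k \<in> {-N..3*N}"
  shows "node N i j k \<in> small_squares"
proof -
  have *: "1/2 + real_of_int m / (16 * N) \<in> {0..1}" if "- 8 * N \<le> m" "m \<le> 8 * N" for m
  proof -
    have "real_of_int m \<le> 8 * N" "- 8 * N \<le> real_of_int m" using that by linarith+
    then show ?thesis using assms(1) by (simp add: field_simps)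
  qed
  have **: "1 - real_of_int m / (16 * N) \<in> {0..<2}" if "- 8 * N \<le> m" "m \<le> 16 * N" for m
  proof -
    have "real_of_int m \<le> 16 * N" "- 8 * N \<le> real_of_int m" using that by linarith+
    then show ?thesis using assms(1) by (simp add: field_simps)
  qed
  have "1/2 + real_of_int (i + j - k) / (16 * N) \<in> {0..1}" "1/2 + real_of_int (i - j + k) / (16 * N) \<in> {0..1}"
    using assms by (intro *; simp)+
  moreover have "1 - real_of_int (i + j + k) / (16 * N) \<in> {0..<2}"
    using assms by (intro **; simp)
  ultimately show ?thesis by (simp add: node_def small_squares_def)
qed

text \<open>
  What a retraction from a bifinite domain would provide for squares; no such map exists.
\<close>

locale finite_rounding =
  fixes g :: "square \<Rightarrow> square"
  assumes finite_range: "finite (g ` small_squares)"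
    and mono: "\<lbrakk>z \<in> small_squares; z' \<in> small_squares; z \<sqsubseteq>\<^bsub>Sq\<^esub> z'\<rbrakk> \<Longrightarrow> g z \<sqsubseteq>\<^bsub>Sq\<^esub> g z'"
    and below: "z \<in> small_squares \<Longrightarrow> g z \<sqsubseteq>\<^bsub>Sq\<^esub> z"
    and above: "(c, r) \<in> small_squares \<Longrightarrow> (c, r + 1/64) \<sqsubseteq>\<^bsub>Sq\<^esub> g (c, r)"
begin

lemma sides_close:
  assumes "z \<in> small_squares" "f \<in> {west, east, south, north}"
  shows "f z - 1/64 \<le> f (g z)" "f (g z) \<le> f z"
proof -
  obtain x y r where z: "z = ((x, y), r)" by (metis surj_pair)
  have "((x, y), r + 1/64) \<sqsubseteq>\<^bsub>Sq\<^esub> g z" using above assms(1) z by blast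
  then show "f z - 1/64 \<le> f (g z)" using assms(2) by (auto simp: le_Sq_iff z sides)
  show "f (g z) \<le> f z" using below[OF assms(1)] assms(2) by (auto simp: le_Sq_iff)
qed

context
  fixes N :: int
  assumes N: "N > 0"
begin

definition rounded :: "int \<Rightarrow> int \<Rightarrow> int \<Rightarrow> square" where
  "rounded i j k = g (node N i j k)"

lemma rounded_mono:
  assumes "i \<in> {-N..3*N}" "j \<in> {-N..3*N}" "k \<in> {-N..3*N}"
    and "i' \<in> {-N..3*N}" "j' \<in> {-N..3*N}" "k' \<in> {-N..3*N}"
    and "i + j \<le> i' + j'" "k \<le> k'" "i + k \<le> i' + k'" "j \<le> j'"
  shows "rounded i j k \<sqsubseteq>\<^bsub>Sq\<^esub> rounded i' j' k'"
proof -
  have "node N i j k \<in> small_squares" "node N i' j' k' \<in> small_squares"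
    using assms by (blast intro: node_in_small_squares[OF N])+
  then show ?thesis
    unfolding rounded_def using node_le[OF N assms(7-10)] by (rule mono)
qed

lemma rounded_bounds:
  assumes "i \<in> {-N..3*N}" "j \<in> {-N..3*N}" "k \<in> {-N..3*N}"
  shows "west (rounded i j k) \<in> {-1/2 + (i + j) / (8 * N) - 1/64 .. -1/2 + (i + j) / (8 * N)}" (is ?W)
    and "south (rounded i j k) \<in> {-1/2 + (i + k) / (8 * N) - 1/64 .. -1/2 + (i + k) / (8 * N)}" (is ?S)
    and "north (rounded i j k) \<in> {-3/2 + j / (8 * N) - 1/64 .. -3/2 + j / (8 * N)}" (is ?N)
proof -
  have "node N i j k \<in> small_squares" by (rule node_in_small_squares[OF N assms])
  note close = sides_close[OF this]
  show ?W
    using close[of west] by (simp add: rounded_def sides_node[OF N])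
  show ?S
    using close[of south] by (simp add: rounded_def sides_node[OF N])
  show ?N
    using close[of north] by (simp add: rounded_def sides_node[OF N])
qed

definition branching :: "int \<Rightarrow> int \<Rightarrow> int \<Rightarrow> int \<Rightarrow> bool" where
  "branching s i j k \<longleftrightarrow> rounded (i + s) j k \<noteq> rounded i j k \<and> rounded i (j + s) k \<noteq> rounded i j k \<and> rounded (i + s) j k \<noteq> rounded i (j + s) k"

text \<open>
  On average the left-hand side is large, as the first step moves the west side, and the three
  differences on the right are small: the second step does not move the south side, the first does
  not move the north side, and the third does not move the west side.  The inequality is a case
  distinction on which two of the three values agree.  If the first two neighbours have equal
  values, the relation \<open>west + east = south + north\<close> bounds the increment of west by
  those of south and north, and the increment of south can be taken along the second step.  If the
  second neighbour has the value of the node itself, then west increases from it along the third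
  step at least as much, because the second plus the third step dominates the first.
\<close>

lemma west_increment_le:
  assumes s: "0 < s" "s \<le> N" and ijk: "i \<in> {0..<N}" "j \<in> {0..<N}" "k \<in> {0..<N}"
  shows "west (rounded (i + s) j k) - west (rounded i j k) \<le>
    (south (rounded i (j + s) k) - south (rounded i j k)) + (north (rounded (i + s) j k) - north (rounded i j k))
    + (west (rounded i (j + s) (k + s)) - west (rounded i (j + s) k)) + of_bool (branching s i j k)"
proof -
  have i: "rounded i j k \<sqsubseteq>\<^bsub>Sq\<^esub> rounded (i + s) j k" using s ijk by (intro rounded_mono) auto
  have j: "rounded i j k \<sqsubseteq>\<^bsub>Sq\<^esub> rounded i (j + s) k" using s ijk by (intro rounded_mono) auto
  have k: "rounded i (j + s) k \<sqsubseteq>\<^bsub>Sq\<^esub> rounded i (j + s) (k + s)" using s ijk by (intro rounded_mono) auto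
  have x: "rounded (i + s) j k \<sqsubseteq>\<^bsub>Sq\<^esub> rounded i (j + s) (k + s)" using s ijk by (intro rounded_mono) auto
  note le = i[unfolded le_Sq_iff] j[unfolded le_Sq_iff] k[unfolded le_Sq_iff] x[unfolded le_Sq_iff]
  show ?thesis
  proof (cases "branching s i j k")
    case True
    have "west (rounded (i + s) j k) \<le> - 1/2 + (real_of_int i + s + j) / (8 * N)"
      using rounded_bounds(1)[of "i + s" j k] s ijk by simp
    moreover have "- 1/2 + (real_of_int i + j) / (8 * N) - 1/64 \<le> west (rounded i j k)"
      using rounded_bounds(1)[of i j k] s ijk by simp
    moreover have "(real_of_int i + s + j) / (8 * N) = (real_of_int i + j) / (8 * N) + s / (8 * N)"
      by (simp add: add_divide_distrib)
    moreover have "s / (8 * N) \<le> 1/8" using s N by (simp add: field_simps)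
    ultimately have "west (rounded (i + s) j k) - west (rounded i j k) \<le> 1" by linarith
    with True le show ?thesis by simp
  next
    case False
    then consider "rounded (i + s) j k = rounded i j k" | "rounded i (j + s) k = rounded i j k" | "rounded (i + s) j k = rounded i (j + s) k"
      by (auto simp: branching_def)
    then show ?thesis
    proof cases
      case 1 then show ?thesis using le False by simp
    next
      case 2 then show ?thesis using le False by simp
    next
      case 3 then show ?thesis using le False balance[of "rounded i j k"] balance[of "rounded (i + s) j k"] by simp
    qed
  qed
qed

text \<open>
  Summing the preceding inequality over the lattice.  Over \<open>N\<close> unit steps a side
  moves by \<open>1/8\<close> or not at all, up to the rounding error \<open>1/64\<close>, and
  telescoping turns this into \<open>1/8 - 1/64 \<le> 3 \<cdot> 1/64\<close> plus the number of
  branching nodes divided by \<open>N\<^sup>2 s\<close>.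
\<close>

lemma card_branching_ge:
  assumes s: "0 < s" "s \<le> N"
  shows "real_of_int N ^ 2 * s / 16 \<le> card {(i, j, k) \<in> {0..<N} \<times> {0..<N} \<times> {0..<N}. branching s i j k}"
proof -
  let ?I = "{0..<N}"
  have cI: "real (card ?I) = N" using N by simp
  have N0: "0 \<le> N" "0 \<le> s" using N s by auto
  have sq: "real (card ?I) * (real (card ?I) * c) = real_of_int N ^ 2 * c" for c
    by (simp only: cI power2_eq_square mult.assoc)
  have d: "real_of_int (i + N) / (8 * N) = i / (8 * N) + 1/8" for i
    using N by (simp add: field_simps)
  have "s * (1/8 - 1/64) \<le> (\<Sum>i\<in>?I. west (rounded (i + s) j k) - west (rounded i j k))" if "j \<in> ?I" "k \<in> ?I" for j k
  proof (rule sum_shift_ge[OF N0(2,1), where F = "\<lambda>i. west (rounded i j k)"])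
    fix i assume "i \<in> {0..<s}"
    then show "1/8 - 1/64 \<le> west (rounded (i + N) j k) - west (rounded i j k)"
      using rounded_bounds(1)[of "i + N" j k] rounded_bounds(1)[of i j k] that s d[of i] by (auto simp: add_divide_distrib)
  qed
  then have 1: "real_of_int N ^ 2 * (s * (1/8 - 1/64)) \<le> (\<Sum>j\<in>?I. \<Sum>k\<in>?I. \<Sum>i\<in>?I. west (rounded (i + s) j k) - west (rounded i j k))"
    by (subst sq[symmetric]) (intro sum_bounded_below)
  have "(\<Sum>j\<in>?I. south (rounded i (j + s) k) - south (rounded i j k)) \<le> s * (1/64)" if "i \<in> ?I" "k \<in> ?I" for i k
  proof (rule sum_shift_le[OF N0(2,1), where F = "\<lambda>j. south (rounded i j k)"])
    fix j assume "j \<in> {0..<s}"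
    then show "south (rounded i (j + N) k) - south (rounded i j k) \<le> 1/64"
      using rounded_bounds(2)[of i "j + N" k] rounded_bounds(2)[of i j k] that s by auto
  qed
  then have 2: "(\<Sum>i\<in>?I. \<Sum>k\<in>?I. \<Sum>j\<in>?I. south (rounded i (j + s) k) - south (rounded i j k)) \<le> real_of_int N ^ 2 * (s * (1/64))"
    by (subst sq[symmetric]) (intro sum_bounded_above)
  have "(\<Sum>i\<in>?I. north (rounded (i + s) j k) - north (rounded i j k)) \<le> s * (1/64)" if "j \<in> ?I" "k \<in> ?I" for j k
  proof (rule sum_shift_le[OF N0(2,1), where F = "\<lambda>i. north (rounded i j k)"])
    fix i assume "i \<in> {0..<s}"
    then show "north (rounded (i + N) j k) - north (rounded i j k) \<le> 1/64"
      using rounded_bounds(3)[of "i + N" j k] rounded_bounds(3)[of i j k] that s by auto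
  qed
  then have 3: "(\<Sum>j\<in>?I. \<Sum>k\<in>?I. \<Sum>i\<in>?I. north (rounded (i + s) j k) - north (rounded i j k)) \<le> real_of_int N ^ 2 * (s * (1/64))"
    by (subst sq[symmetric]) (intro sum_bounded_above)
  have "(\<Sum>k\<in>?I. west (rounded i (j + s) (k + s)) - west (rounded i (j + s) k)) \<le> s * (1/64)" if "i \<in> ?I" "j \<in> ?I" for i j
  proof (rule sum_shift_le[OF N0(2,1), where F = "\<lambda>k. west (rounded i (j + s) k)"])
    fix k assume "k \<in> {0..<s}"
    then show "west (rounded i (j + s) (k + N)) - west (rounded i (j + s) k) \<le> 1/64"
      using rounded_bounds(1)[of i "j + s" "k + N"] rounded_bounds(1)[of i "j + s" k] that s by auto
  qed
  then have 4: "(\<Sum>i\<in>?I. \<Sum>j\<in>?I. \<Sum>k\<in>?I. west (rounded i (j + s) (k + s)) - west (rounded i (j + s) k)) \<le> real_of_int N ^ 2 * (s * (1/64))"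
    by (subst sq[symmetric]) (intro sum_bounded_above)
  have swap1: "(\<Sum>j\<in>?I. \<Sum>k\<in>?I. \<Sum>i\<in>?I. F i j k) = (\<Sum>i\<in>?I. \<Sum>j\<in>?I. \<Sum>k\<in>?I. F i j k)"
    for F :: "int \<Rightarrow> int \<Rightarrow> int \<Rightarrow> real"
  proof -
    have "(\<Sum>j\<in>?I. \<Sum>k\<in>?I. \<Sum>i\<in>?I. F i j k) = (\<Sum>j\<in>?I. \<Sum>i\<in>?I. \<Sum>k\<in>?I. F i j k)"
      by (rule sum.cong[OF refl]) (rule sum.swap)
    also have "\<dots> = (\<Sum>i\<in>?I. \<Sum>j\<in>?I. \<Sum>k\<in>?I. F i j k)"
      by (rule sum.swap)
    finally show ?thesis .
  qed
  have swap2: "(\<Sum>i\<in>?I. \<Sum>k\<in>?I. \<Sum>j\<in>?I. F i j k) = (\<Sum>i\<in>?I. \<Sum>j\<in>?I. \<Sum>k\<in>?I. F i j k)"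
    for F :: "int \<Rightarrow> int \<Rightarrow> int \<Rightarrow> real"
    by (rule sum.cong[OF refl]) (rule sum.swap)
  have "(\<Sum>i\<in>?I. \<Sum>j\<in>?I. \<Sum>k\<in>?I. west (rounded (i + s) j k) - west (rounded i j k)) \<le>
    (\<Sum>i\<in>?I. \<Sum>j\<in>?I. \<Sum>k\<in>?I. (south (rounded i (j + s) k) - south (rounded i j k)) + (north (rounded (i + s) j k) - north (rounded i j k))
    + (west (rounded i (j + s) (k + s)) - west (rounded i (j + s) k)) + of_bool (branching s i j k))"
    by (intro sum_mono west_increment_le s)
  also have "\<dots> = (\<Sum>i\<in>?I. \<Sum>j\<in>?I. \<Sum>k\<in>?I. south (rounded i (j + s) k) - south (rounded i j k))
      + (\<Sum>i\<in>?I. \<Sum>j\<in>?I. \<Sum>k\<in>?I. north (rounded (i + s) j k) - north (rounded i j k))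
      + (\<Sum>i\<in>?I. \<Sum>j\<in>?I. \<Sum>k\<in>?I. west (rounded i (j + s) (k + s)) - west (rounded i (j + s) k))
      + (\<Sum>i\<in>?I. \<Sum>j\<in>?I. \<Sum>k\<in>?I. of_bool (branching s i j k))"
    unfolding sum.distrib by (simp only: add.assoc)
  finally have "real_of_int N ^ 2 * (s * (1/8 - 1/64)) \<le> 3 * (real_of_int N ^ 2 * (s * (1/64)))
      + (\<Sum>i\<in>?I. \<Sum>j\<in>?I. \<Sum>k\<in>?I. of_bool (branching s i j k))"
    using 1 2 3 4
      swap1[of "\<lambda>i j k. west (rounded (i + s) j k) - west (rounded i j k)"]
      swap1[of "\<lambda>i j k. north (rounded (i + s) j k) - north (rounded i j k)"]
      swap2[of "\<lambda>i j k. south (rounded i (j + s) k) - south (rounded i j k)"]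
    by linarith
  moreover have "(\<Sum>i\<in>?I. \<Sum>j\<in>?I. \<Sum>k\<in>?I. of_bool (branching s i j k)) =
      real (card {(i, j, k) \<in> ?I \<times> ?I \<times> ?I. branching s i j k})"
  proof -
    have "(\<Sum>i\<in>?I. \<Sum>j\<in>?I. \<Sum>k\<in>?I. of_bool (branching s i j k)) =
        (\<Sum>(i, j, k)\<in>?I \<times> ?I \<times> ?I. of_bool (branching s i j k) :: real)"
      by (simp only: sum.cartesian_product)
    also have "\<dots> = (\<Sum>p\<in>?I \<times> ?I \<times> ?I. if case p of (i, j, k) \<Rightarrow> branching s i j k then 1 else 0)"
      by (rule sum.cong) auto
    also have "\<dots> = (\<Sum>p | p \<in> ?I \<times> ?I \<times> ?I \<and> (case p of (i, j, k) \<Rightarrow> branching s i j k). 1)"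
      by (rule sum.inter_filter[symmetric]) simp
    also have "{p. p \<in> ?I \<times> ?I \<times> ?I \<and> (case p of (i, j, k) \<Rightarrow> branching s i j k)} =
        {(i, j, k) \<in> ?I \<times> ?I \<times> ?I. branching s i j k}"
      by auto
    finally show ?thesis by (simp only: sum_constant mult_1_right)
  qed
  ultimately show ?thesis by (simp add: field_simps)
qed

text \<open>
  On the diagonal through the node \<open>(i, j, k)\<close>, which is already in the upper set of
  \<open>v'\<close> but not yet in that of \<open>v\<close>, both boundaries are passed within
  distance \<open>s\<close> of it.
\<close>

definition crossing :: "square \<Rightarrow> square \<Rightarrow> int \<Rightarrow> int \<Rightarrow> int \<Rightarrow> int \<Rightarrow> bool" where
  "crossing v v' s i j k \<longleftrightarrow>
     v' \<sqsubseteq>\<^bsub>Sq\<^esub> rounded i j k \<and> \<not> v \<sqsubseteq>\<^bsub>Sq\<^esub> rounded i j k \<and>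
     \<not> v' \<sqsubseteq>\<^bsub>Sq\<^esub> rounded (i - s) (j - s) k \<and> v \<sqsubseteq>\<^bsub>Sq\<^esub> rounded (i + s) (j + s) k"

lemma rounded_in_range:
  assumes "i \<in> {-N..3*N}" "j \<in> {-N..3*N}" "k \<in> {-N..3*N}"
  shows "rounded i j k \<in> g ` small_squares"
  unfolding rounded_def by (rule imageI) (rule node_in_small_squares[OF N assms])

text \<open>
  Of two distinct neighbouring values, one is not below the other, say \<open>a\<close> is not
  below \<open>b\<close>.  At the neighbour with value \<open>b\<close> the upper set of
  \<open>b\<close> has been entered and that of \<open>a\<close> has not.  The diagonal is used
  because its step dominates both of the first two steps: going back along it leads below the
  original node, where \<open>b\<close> is not reached, and going forth leads above the other
  neighbour, where \<open>a\<close> is reached.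
\<close>

lemma branching_imp_crossing:
  assumes s: "0 < s" "s \<le> N" and ijk: "i \<in> {0..<N}" "j \<in> {0..<N}" "k \<in> {0..<N}"
    and br: "branching s i j k"
  shows "\<exists>v\<in>g ` small_squares. \<exists>v'\<in>g ` small_squares. crossing v v' s i (j + s) k \<or> crossing v v' s (i + s) j k"
proof -
  define u a b where "u = rounded i j k" and "a = rounded (i + s) j k" and "b = rounded i (j + s) k"
  have ne: "a \<noteq> u" "b \<noteq> u" "a \<noteq> b" using br by (auto simp: branching_def u_def a_def b_def)
  have mem: "a \<in> g ` small_squares" "b \<in> g ` small_squares" unfolding a_def b_def using s ijk by (auto intro!: rounded_in_range)
  have ua: "u \<sqsubseteq>\<^bsub>Sq\<^esub> a" and ub: "u \<sqsubseteq>\<^bsub>Sq\<^esub> b"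
    unfolding u_def a_def b_def using s ijk by (auto intro!: rounded_mono)
  have lower: "rounded (i - s) j k \<sqsubseteq>\<^bsub>Sq\<^esub> u" "rounded i (j - s) k \<sqsubseteq>\<^bsub>Sq\<^esub> u"
    unfolding u_def using s ijk by (auto intro!: rounded_mono)
  have upper: "a \<sqsubseteq>\<^bsub>Sq\<^esub> rounded (i + s) (j + s + s) k" "b \<sqsubseteq>\<^bsub>Sq\<^esub> rounded (i + s + s) (j + s) k"
    unfolding a_def b_def using s ijk by (auto intro!: rounded_mono)
  have strict: "\<not> a \<sqsubseteq>\<^bsub>Sq\<^esub> rounded i (j - s) k" "\<not> b \<sqsubseteq>\<^bsub>Sq\<^esub> rounded (i - s) j k"
    using ne ua ub lower le_Sq_trans le_Sq_antisym by metis+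
  have "\<not> a \<sqsubseteq>\<^bsub>Sq\<^esub> b \<or> \<not> b \<sqsubseteq>\<^bsub>Sq\<^esub> a" using ne le_Sq_antisym by blast
  then show ?thesis
  proof
    assume "\<not> a \<sqsubseteq>\<^bsub>Sq\<^esub> b"
    then have "crossing a b s i (j + s) k"
      using strict upper le_Sq_refl[of b] by (simp add: crossing_def b_def)
    then show ?thesis using mem by blast
  next
    assume "\<not> b \<sqsubseteq>\<^bsub>Sq\<^esub> a"
    then have "crossing b a s (i + s) j k"
      using strict upper le_Sq_refl[of a] by (simp add: crossing_def a_def)
    then show ?thesis using mem by blast
  qed
qed

lemma card_branching_le:
  assumes s: "0 < s" "s \<le> N"
  shows "card {(i, j, k) \<in> {0..<N} \<times> {0..<N} \<times> {0..<N}. branching s i j k} \<le>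
    (\<Sum>(v, v') \<in> g ` small_squares \<times> g ` small_squares. 2 * card {(i, j, k) \<in> {0..<2*N} \<times> {0..<2*N} \<times> {0..<N}. crossing v v' s i j k})"
    (is "card ?T \<le> (\<Sum>(v, v') \<in> ?M. 2 * card (?Q v v'))")
proof -
  let ?S = "\<lambda>p. case p of (v, v') \<Rightarrow> (\<lambda>(i, j, k). (i, j - s, k)) ` ?Q v v' \<union> (\<lambda>(i, j, k). (i - s, j, k)) ` ?Q v v'"
  have finQ: "finite (?Q v v')" for v v'
    by (rule finite_subset[of _ "{0..<2*N} \<times> {0..<2*N} \<times> {0..<N}"]) auto
  have sub: "?T \<subseteq> (\<Union>p\<in>?M. ?S p)"
  proof
    fix p assume "p \<in> ?T"
    then obtain i j k where p: "p = (i, j, k)" and ijk: "i \<in> {0..<N}" "j \<in> {0..<N}" "k \<in> {0..<N}"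
      and br: "branching s i j k" by auto
    obtain v v' where v: "v \<in> g ` small_squares" "v' \<in> g ` small_squares"
      and cr: "crossing v v' s i (j + s) k \<or> crossing v v' s (i + s) j k"
      using branching_imp_crossing[OF s ijk br] by blast
    from cr have "p \<in> ?S (v, v')"
    proof
      assume "crossing v v' s i (j + s) k"
      then have "(i, j + s, k) \<in> ?Q v v'" using s ijk by auto
      then have "p \<in> (\<lambda>(i, j, k). (i, j - s, k)) ` ?Q v v'" unfolding p by (rule rev_image_eqI) simp
      then show ?thesis by simp
    next
      assume "crossing v v' s (i + s) j k"
      then have "(i + s, j, k) \<in> ?Q v v'" using s ijk by auto
      then have "p \<in> (\<lambda>(i, j, k). (i - s, j, k)) ` ?Q v v'" unfolding p by (rule rev_image_eqI) simp
      then show ?thesis by simp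
    qed
    then show "p \<in> (\<Union>p\<in>?M. ?S p)" using v by blast
  qed
  have finM: "finite ?M" using finite_range by simp
  have finS: "finite (?S p)" for p using finQ by (auto split: prod.splits)
  have "card ?T \<le> card (\<Union>p\<in>?M. ?S p)"
    by (rule card_mono[OF _ sub]) (use finM finS in blast)
  also have "\<dots> \<le> (\<Sum>p\<in>?M. card (?S p))" by (rule card_UN_le[OF finM])
  also have "\<dots> \<le> (\<Sum>(v, v')\<in>?M. 2 * card (?Q v v'))"
  proof (rule sum_mono)
    fix p :: "square \<times> square"
    obtain v v' where p: "p = (v, v')" by (rule prod.exhaust)
    have "card (?S (v, v')) \<le> card ((\<lambda>(i, j, k). (i, j - s, k)) ` ?Q v v') + card ((\<lambda>(i, j, k). (i - s, j, k)) ` ?Q v v')"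
      by (simp only: prod.case card_Un_le)
    also have "\<dots> \<le> card (?Q v v') + card (?Q v v')"
      by (intro add_mono card_image_le finQ)
    finally show "card (?S p) \<le> (case p of (v, v') \<Rightarrow> 2 * card (?Q v v'))" by (simp add: p)
  qed
  finally show ?thesis .
qed

text \<open>
  There are \<open>N\<close> values of \<open>k\<close> and fewer than \<open>4 N\<close>
  diagonals \<open>i - j = c\<close>, and every one of these lines contributes at most
  \<open>4\<close> over all scales.
\<close>

lemma sum_card_crossings_le:
  assumes K: "\<And>l. l < K \<Longrightarrow> 2 ^ l \<le> N"
  shows "(\<Sum>l<K. real (card {(i, j, k) \<in> {0..<2*N} \<times> {0..<2*N} \<times> {0..<N}. crossing v v' (2 ^ l) i j k}) / 2 ^ l)
    \<le> 16 * real_of_int N ^ 2"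
proof -
  \<comment> \<open>The part of the diagonal on which both indices \<open>t\<close> and \<open>t - c\<close>
      lie in \<open>{-N..3*N}\<close>.\<close>
  define lo hi where "lo c = max (- N) (c - N)" and "hi c = min (3 * N) (3 * N + c)" for c
  define X where "X k c s = {t. lo c \<le> t - s \<and> t + s \<le> hi c \<and> v' \<sqsubseteq>\<^bsub>Sq\<^esub> rounded t (t - c) k \<and> \<not> v \<sqsubseteq>\<^bsub>Sq\<^esub> rounded t (t - c) k
      \<and> \<not> v' \<sqsubseteq>\<^bsub>Sq\<^esub> rounded (t - s) (t - s - c) k \<and> v \<sqsubseteq>\<^bsub>Sq\<^esub> rounded (t + s) (t + s - c) k}" for k c s
  let ?Q = "\<lambda>s. {(i, j, k) \<in> {0..<2*N} \<times> {0..<2*N} \<times> {0..<N}. crossing v v' s i j k}"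
  let ?C = "{- 2 * N<..<2 * N}"
  have finX: "finite (X k c s)" if "0 < s" for k c s
    by (rule finite_subset[of _ "{- N..3 * N}"]) (use that in \<open>auto simp: X_def lo_def hi_def\<close>)
  have diagonal: "(\<Sum>l<K. real (card (X k c (2 ^ l))) / 2 ^ l) \<le> 4" if k: "k \<in> {0..<N}" for k c
  proof -
    have up: "rounded t (t - c) k \<sqsubseteq>\<^bsub>Sq\<^esub> rounded t' (t' - c) k" if "lo c \<le> t" "t \<le> t'" "t' \<le> hi c" for t t'
      using that k N by (intro rounded_mono) (auto simp: lo_def hi_def)
    show ?thesis unfolding X_def
      by (rule sum_dyadic_crossings_le) (blast intro: le_Sq_trans up)+
  qed
  have "real (card (?Q s)) \<le> (\<Sum>k\<in>{0..<N}. \<Sum>c\<in>?C. real (card (X k c s)))" if s: "0 < s" "s \<le> N" for s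
  proof -
    have "?Q s \<subseteq> (\<Union>k\<in>{0..<N}. \<Union>c\<in>?C. (\<lambda>t. (t, t - c, k)) ` X k c s)"
    proof
      fix p assume "p \<in> ?Q s"
      then obtain i j k where p: "p = (i, j, k)" and ijk: "i \<in> {0..<2*N}" "j \<in> {0..<2*N}" "k \<in> {0..<N}"
        and cr: "crossing v v' s i j k" by auto
      have "i \<in> X k (i - j) s"
        using cr ijk s by (auto simp: X_def crossing_def lo_def hi_def algebra_simps)
      then have "p \<in> (\<lambda>t. (t, t - (i - j), k)) ` X k (i - j) s" unfolding p by (rule rev_image_eqI) simp
      moreover have "i - j \<in> ?C" using ijk by auto
      ultimately show "p \<in> (\<Union>k\<in>{0..<N}. \<Union>c\<in>?C. (\<lambda>t. (t, t - c, k)) ` X k c s)" using ijk by blast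
    qed
    then have "card (?Q s) \<le> card (\<Union>k\<in>{0..<N}. \<Union>c\<in>?C. (\<lambda>t. (t, t - c, k)) ` X k c s)"
      by (intro card_mono) (use finX s in auto)
    also have "\<dots> \<le> (\<Sum>k\<in>{0..<N}. card (\<Union>c\<in>?C. (\<lambda>t. (t, t - c, k)) ` X k c s))"
      by (rule card_UN_le) simp
    also have "\<dots> \<le> (\<Sum>k\<in>{0..<N}. \<Sum>c\<in>?C. card ((\<lambda>t. (t, t - c, k)) ` X k c s))"
      by (intro sum_mono card_UN_le) simp
    also have "\<dots> \<le> (\<Sum>k\<in>{0..<N}. \<Sum>c\<in>?C. card (X k c s))"
      by (intro sum_mono card_image_le finX s)
    finally show ?thesis by (simp flip: of_nat_sum)
  qed
  then have "(\<Sum>l<K. real (card (?Q (2 ^ l))) / 2 ^ l)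
      \<le> (\<Sum>l<K. (\<Sum>k\<in>{0..<N}. \<Sum>c\<in>?C. real (card (X k c (2 ^ l)))) / 2 ^ l)"
    using K by (intro sum_mono divide_right_mono) auto
  also have "\<dots> = (\<Sum>l<K. \<Sum>k\<in>{0..<N}. \<Sum>c\<in>?C. real (card (X k c (2 ^ l))) / 2 ^ l)"
    by (simp only: sum_divide_distrib)
  also have "\<dots> = (\<Sum>k\<in>{0..<N}. \<Sum>l<K. \<Sum>c\<in>?C. real (card (X k c (2 ^ l))) / 2 ^ l)"
    by (rule sum.swap)
  also have "\<dots> = (\<Sum>k\<in>{0..<N}. \<Sum>c\<in>?C. \<Sum>l<K. real (card (X k c (2 ^ l))) / 2 ^ l)"
    by (rule sum.cong[OF refl]) (rule sum.swap)
  also have "\<dots> \<le> (\<Sum>k\<in>{0..<N}. \<Sum>c\<in>?C. 4)"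
    by (intro sum_mono diagonal)
  also have "\<dots> = real_of_int N * (4 * N - 1) * 4" using N by simp
  also have "\<dots> \<le> 16 * real_of_int N ^ 2" using N by (simp add: power2_eq_square algebra_simps)
  finally show ?thesis .
qed

end

lemma finite_rounding_impossible: False
proof -
  define m where "m = card (g ` small_squares \<times> g ` small_squares)"
  \<comment> \<open>With \<open>m\<close> pairs of values the upper bound for the sum over \<open>K\<close>
      scales is \<open>32 m N\<^sup>2\<close>, the lower bound is \<open>K N\<^sup>2 /
      16\<close>.\<close>
  define K where "K = 512 * m + 1"
  define N :: int where "N = 2 ^ K"
  have N: "N > 0" by (simp add: N_def)
  have pow: "2 ^ l \<le> N" if "l < K" for l
    unfolding N_def using that by (intro power_increasing) auto
  let ?T = "\<lambda>s. {(i, j, k) \<in> {0..<N} \<times> {0..<N} \<times> {0..<N}. branching N s i j k}"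
  let ?Q = "\<lambda>v v' s. {(i, j, k) \<in> {0..<2*N} \<times> {0..<2*N} \<times> {0..<N}. crossing N v v' s i j k}"
  have "K * (real_of_int N ^ 2 / 16) \<le> (\<Sum>l<K. real (card (?T (2 ^ l))) / 2 ^ l)"
  proof -
    have "real_of_int N ^ 2 / 16 \<le> real (card (?T (2 ^ l))) / 2 ^ l" if "l \<in> {..<K}" for l
    proof -
      have "real_of_int N ^ 2 * real_of_int (2 ^ l) / 16 \<le> card (?T (2 ^ l))"
        using that by (intro card_branching_ge[OF N] pow) auto
      then show ?thesis by (simp add: field_simps)
    qed
    from sum_bounded_below[of "{..<K}", OF this] show ?thesis by (simp only: card_lessThan)
  qed
  also have "\<dots> \<le> (\<Sum>l<K. (\<Sum>(v, v') \<in> g ` small_squares \<times> g ` small_squares. 2 * real (card (?Q v v' (2 ^ l)))) / 2 ^ l)"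
  proof (intro sum_mono divide_right_mono)
    fix l assume "l \<in> {..<K}"
    then have "card (?T (2 ^ l)) \<le> (\<Sum>(v, v') \<in> g ` small_squares \<times> g ` small_squares. 2 * card (?Q v v' (2 ^ l)))"
      by (intro card_branching_le[OF N] pow) auto
    then have "real (card (?T (2 ^ l))) \<le> real (\<Sum>(v, v') \<in> g ` small_squares \<times> g ` small_squares. 2 * card (?Q v v' (2 ^ l)))"
      by (rule of_nat_mono)
    then show "real (card (?T (2 ^ l))) \<le> (\<Sum>(v, v') \<in> g ` small_squares \<times> g ` small_squares. 2 * real (card (?Q v v' (2 ^ l))))"
      by (simp add: case_prod_unfold)
  qed simp
  also have "\<dots> = (\<Sum>(v, v') \<in> g ` small_squares \<times> g ` small_squares. 2 * (\<Sum>l<K. real (card (?Q v v' (2 ^ l))) / 2 ^ l))"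
    unfolding sum_divide_distrib by (subst sum.swap) (simp add: case_prod_unfold sum_distrib_left)
  also have "\<dots> \<le> (\<Sum>(v, v') \<in> g ` small_squares \<times> g ` small_squares. 2 * (16 * real_of_int N ^ 2))"
    by (rule sum_mono, clarify) (intro mult_left_mono sum_card_crossings_le[OF N] pow; simp)
  also have "\<dots> = m * (32 * real_of_int N ^ 2)" by (simp add: m_def case_prod_unfold)
  finally have "real_of_int N ^ 2 * (real K / 16) \<le> real_of_int N ^ 2 * (32 * m)" by (simp add: mult_ac)
  then have "real K / 16 \<le> 32 * m" using N by simp
  then show False by (simp add: K_def)
qed

end

section \<open>The FS-domain of squares is not an RB-domain\<close>

text \<open>
  Two applications of the enlargement by \<open>1/128\<close> account for the rounding error
  \<open>1/64\<close>, and radii below \<open>2\<close> stay away from the cut-off, so the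
  finite-range approximation never takes the value \<open>\<bottom>\<close> there.
\<close>

lemma not_RB_domain_Sq_bot: "\<not> RB_domain TYPE('b) Sq_bot"
proof
  assume RB: "RB_domain TYPE('b) Sq_bot"
  have "finitely_separated Sq_bot (enlarge 128)" by (rule finitely_separated_enlarge) simp
  obtain g where fin: "finite (g ` carrier Sq_bot)"
    and mono: "\<And>z z'. \<lbrakk>z \<in> carrier Sq_bot; z' \<in> carrier Sq_bot; z \<sqsubseteq>\<^bsub>Sq_bot\<^esub> z'\<rbrakk> \<Longrightarrow> g z \<sqsubseteq>\<^bsub>Sq_bot\<^esub> g z'"
    and below: "\<And>z. z \<in> carrier Sq_bot \<Longrightarrow> g z \<sqsubseteq>\<^bsub>Sq_bot\<^esub> z"
    and above: "\<And>z. z \<in> carrier Sq_bot \<Longrightarrow> enlarge 128 (enlarge 128 z) \<sqsubseteq>\<^bsub>Sq_bot\<^esub> g z"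
    by (rule RB_domain_finite_range_approximation[OF RB \<open>finitely_separated Sq_bot (enlarge 128)\<close>]) (rule that)
  have D: "Some z \<in> carrier Sq_bot" if "z \<in> small_squares" for z
    using that by (auto simp: small_squares_def carrier_Sq_bot carrier_Sq)
  have twice: "enlarge 128 (enlarge 128 (Some (c, r))) = Some (c, r + 1/64)" if "(c, r) \<in> small_squares" for c r
    using that by (auto simp: small_squares_def enlarge_simps carrier_Sq)
  have some: "g (Some z) = Some (the (g (Some z)))" if "z \<in> small_squares" for z
    using above[OF D[OF that]] twice[of "fst z" "snd z"] that by (cases "g (Some z)") auto
  have "finite_rounding (\<lambda>z. the (g (Some z)))"
  proof
    show "finite ((\<lambda>z. the (g (Some z))) ` small_squares)"
      by (rule finite_subset[OF _ finite_imageI[OF fin, of the]]) (use D in auto)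
    show "the (g (Some z)) \<sqsubseteq>\<^bsub>Sq\<^esub> the (g (Some z'))" if "z \<in> small_squares" "z' \<in> small_squares" "z \<sqsubseteq>\<^bsub>Sq\<^esub> z'" for z z'
      using mono[OF D D, OF that(1,2)] that(3) some[OF that(1)] some[OF that(2)] by (metis le_Sq_bot_simps(3))
    show "the (g (Some z)) \<sqsubseteq>\<^bsub>Sq\<^esub> z" if "z \<in> small_squares" for z
      using below[OF D[OF that]] some[OF that] by (metis le_Sq_bot_simps(3))
    show "(c, r + 1/64) \<sqsubseteq>\<^bsub>Sq\<^esub> the (g (Some (c, r)))" if "(c, r) \<in> small_squares" for c r
      using above[OF D[OF that]] twice[OF that] some[OF that] by (metis le_Sq_bot_simps(3))
  qed
  then show False by (rule finite_rounding.finite_rounding_impossible)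
qed

theorem theorem1p1:
  shows "FS_domain Sq_bot \<and> \<not> RB_domain TYPE('b) Sq_bot"
  using FS_domain_Sq_bot not_RB_domain_Sq_bot by blast

end
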